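(* Let $G$ be a finite abelian group with $b\ge2$ elements, $s,n\ge1$ integers, and $P$ a subgroup of $\mathbb{X}_n^s$. For $X\in\mathbb{X}_n^s$ let $x_i\in\mathbb{X}_n$ denote its $i$-th row. For $a\ge 0$ let $N_a=\#\{K\in P^\perp:\mu(K)=a\}$. Then $$\sum_{a=0}^{ns}N_a z^a=\frac{1}{\#(P)}\sum_{X\in P}\prod_{i=1}^s p(\mu^*(x_i);z),$$ where for integers $0\le h\le n$ $$p(h;z):=\begin{cases}1+\sum_{a=1}^n z^a(b^a-b^{a-1}) & \text{if } h=0,\\ 1+\sum_{a=1}^{h-1}z^a(b^a-b^{a-1})-z^hb^{h-1} & \text{if } h>0.\end{cases}$$ Suppose moreover that $\#(P)=b^m$ with $1\le m\le n$. Then $P$ is a strict $(t,m,s)$-net in base $b$ with $$t=m+1-\min\{a: 1\le a\le ns,\ N_a\ne0\},$$ where, if $N_1=\cdots=N_{ns}=0$, the minimum is set to be $ns+1$.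
   Context: $\mathbb{X}_n:=G^n$, and $\mathbb{X}_n^s$ is identified with the additive group of $s\times n$ matrices $X=(\xi_{i,j})$ over $G$. $T=\{z\in\mathbb{C}:|z|=1\}$; $G^*=\mathrm{Hom}(G,T)$ is the dual (character) group, written additively, so $0\in G^*$ is the trivial character. $\mathbb{K}_n:=(G^* )^n$, and $\mathbb{K}_n^s$ is identified with the $s\times n$ matrices $K=(\kappa_{i,j})$ over $G^*$. Pairing: $K\bullet X:=\prod_{i,j}\kappa_{i,j}(\xi_{i,j})\in T$. $P^\perp:=\{K\in\mathbb{K}_n^s: K\bullet X=1 \text{ for all } X\in P\}$. NRT weight: for $k=(\kappa_1,\ldots,\kappa_n)\in\mathbb{K}_n$, $\mu(k)=\max\{j:\kappa_j\ne 0\}$ if $k\neq 0$ and $\mu(0)=0$; for $K\in\mathbb{K}_n^s$ with rows $k_1,\ldots,k_s$, $\mu(K)=\sum_{i=1}^s\mu(k_i)$. Dual NRT weight: for $x=(\xi_1,\ldots,\xi_n)\in\mathbb{X}_n$, $\mu^*(x)=\min\{i:\xi_i\ne0\}$ if $x\ne0$ and $\mu^*(0)=0$. Nets: a set of $b^m$ points in $[0,1)^s$ is a $(t,m,s)$-net in base $b$ ($0\le t\le m$ an integer) if for all integers $d_1,\ldots,d_s\ge0$ with $d_1+\cdots+d_s=m-t$ and all integers $0\le a_i<b^{d_i}$, the interval $\prod_{i=1}^s[a_i b^{-d_i},(a_i+1)b^{-d_i})$ contains exactly $b^t$ of the points. Fix a bijection $\varphi:\{0,\ldots,b-1\}\to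 G$ with $\varphi(0)=0$; it induces the injection $\varphi^{-1}:\mathbb{X}_n^s\to[0,1)^s$ sending $X$ to the point with $i$-th coordinate $\sum_{j=1}^n\varphi^{-1}(\xi_{i,j})b^{-j}$. A subset $P\subset\mathbb{X}_n^s$ is a $(t,m,s)$-net in base $b$ if $\varphi^{-1}(P)$ is; it is strict if $t$ is the smallest value for which this holds. *)

theory Defs
  imports Complex_Main "HOL-Algebra.Product_Groups"
begin

text \<open>
  The group \<open>G\<close> is a HOL-Algebra group, hence written multiplicatively: \<open>\<one>\<^bsub>G\<^esub>\<close> is the
  zero of the mathematical text, and the trivial character is the unit of the dual group.
\<close>

definition circle_group :: "complex monoid" where
  "circle_group = \<lparr>carrier = {z. cmod z = 1}, monoid.mult = (*), one = 1\<rparr>"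

text \<open>
  \<^const>\<open>hom\<close> leaves the values of a homomorphism outside \<^term>\<open>carrier G\<close> unspecified.
  Characters are therefore required to be extensional, so that each one is counted once.
\<close>

definition dual_group :: "('a, 'm) monoid_scheme \<Rightarrow> ('a \<Rightarrow> complex) monoid" where
  "dual_group G =
     \<lparr>carrier = hom G circle_group \<inter> extensional (carrier G),
      monoid.mult = (\<lambda>\<kappa> \<rho>. \<lambda>x\<in>carrier G. \<kappa> x * \<rho> x),
      one = (\<lambda>x\<in>carrier G. 1)\<rparr>"

definition row_group :: "('a, 'm) monoid_scheme \<Rightarrow> nat \<Rightarrow> (nat \<Rightarrow> 'a) monoid" where
  "row_group G n = product_group {1..n} (\<lambda>_. G)"

definition matrix_group :: "('a, 'm) monoid_scheme \<Rightarrow> nat \<Rightarrow> nat \<Rightarrow> (nat \<Rightarrow> nat \<Rightarrow> 'a) monoid" where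
  "matrix_group G s n = product_group {1..s} (\<lambda>_. row_group G n)"

definition pairing ::
    "nat \<Rightarrow> nat \<Rightarrow> (nat \<Rightarrow> nat \<Rightarrow> 'a \<Rightarrow> complex) \<Rightarrow> (nat \<Rightarrow> nat \<Rightarrow> 'a) \<Rightarrow> complex" where
  "pairing s n K X = (\<Prod>i=1..s. \<Prod>j=1..n. K i j (X i j))"

definition perp ::
    "('a, 'm) monoid_scheme \<Rightarrow> nat \<Rightarrow> nat \<Rightarrow> (nat \<Rightarrow> nat \<Rightarrow> 'a) set
      \<Rightarrow> (nat \<Rightarrow> nat \<Rightarrow> 'a \<Rightarrow> complex) set" where
  "perp G s n P =
     {K \<in> carrier (matrix_group (dual_group G) s n). \<forall>X\<in>P. pairing s n K X = 1}"

text \<open>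
  In the next two definitions \<open>H\<close> is the group the entries are taken from: the weight is
  used with \<^term>\<open>dual_group G\<close>, the dual weight with \<open>G\<close> itself.
\<close>

definition nrt_weight :: "('c, 'm) monoid_scheme \<Rightarrow> nat \<Rightarrow> (nat \<Rightarrow> 'c) \<Rightarrow> nat" where
  "nrt_weight H n k =
     (if k = \<one>\<^bsub>row_group H n\<^esub> then 0 else Max {j \<in> {1..n}. k j \<noteq> \<one>\<^bsub>H\<^esub>})"

definition dual_nrt_weight :: "('c, 'm) monoid_scheme \<Rightarrow> nat \<Rightarrow> (nat \<Rightarrow> 'c) \<Rightarrow> nat" where
  "dual_nrt_weight H n x =
     (if x = \<one>\<^bsub>row_group H n\<^esub> then 0 else Min {i \<in> {1..n}. x i \<noteq> \<one>\<^bsub>H\<^esub>})"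

definition matrix_weight ::
    "('c, 'm) monoid_scheme \<Rightarrow> nat \<Rightarrow> nat \<Rightarrow> (nat \<Rightarrow> nat \<Rightarrow> 'c) \<Rightarrow> nat" where
  "matrix_weight H s n K = (\<Sum>i=1..s. nrt_weight H n (K i))"

definition weight_count ::
    "('a, 'm) monoid_scheme \<Rightarrow> nat \<Rightarrow> nat \<Rightarrow> (nat \<Rightarrow> nat \<Rightarrow> 'a) set \<Rightarrow> nat \<Rightarrow> nat" where
  "weight_count G s n P a =
     card {K \<in> perp G s n P. matrix_weight (dual_group G) s n K = a}"

definition min_weight ::
    "('a, 'm) monoid_scheme \<Rightarrow> nat \<Rightarrow> nat \<Rightarrow> (nat \<Rightarrow> nat \<Rightarrow> 'a) set \<Rightarrow> nat" where
  "min_weight G s n P =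
     (if \<forall>a\<in>{1..n * s}. weight_count G s n P a = 0 then n * s + 1
      else Min {a \<in> {1..n * s}. weight_count G s n P a \<noteq> 0})"

definition p_poly :: "nat \<Rightarrow> nat \<Rightarrow> nat \<Rightarrow> complex \<Rightarrow> complex" where
  "p_poly b n h z =
     (if h = 0 then 1 + (\<Sum>a=1..n. z ^ a * (of_nat b ^ a - of_nat b ^ (a - 1)))
      else 1 + (\<Sum>a=1..h - 1. z ^ a * (of_nat b ^ a - of_nat b ^ (a - 1)))
             - z ^ h * of_nat b ^ (h - 1))"

text \<open>A point of the half-open unit cube is an extensional function on \<^term>\<open>{1..s}\<close>.\<close>

definition is_net :: "nat \<Rightarrow> nat \<Rightarrow> nat \<Rightarrow> nat \<Rightarrow> (nat \<Rightarrow> real) set \<Rightarrow> bool" where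
  "is_net b t m s Q \<longleftrightarrow>
     t \<le> m \<and> Q \<subseteq> ({1..s} \<rightarrow>\<^sub>E {0..<1}) \<and> card Q = b ^ m \<and>
     (\<forall>d a :: nat \<Rightarrow> nat.
        (\<Sum>i=1..s. d i) = m - t \<longrightarrow> (\<forall>i\<in>{1..s}. a i < b ^ d i) \<longrightarrow>
        card {x \<in> Q. \<forall>i\<in>{1..s}.
                x i \<in> {real (a i) / real b ^ d i ..< (real (a i) + 1) / real b ^ d i}} = b ^ t)"

definition to_point ::
    "nat \<Rightarrow> (nat \<Rightarrow> 'a) \<Rightarrow> nat \<Rightarrow> nat \<Rightarrow> (nat \<Rightarrow> nat \<Rightarrow> 'a) \<Rightarrow> nat \<Rightarrow> real" where
  "to_point b \<phi> s n X =
     (\<lambda>i\<in>{1..s}. \<Sum>j=1..n. real (inv_into {..<b} \<phi> (X i j)) / real b ^ j)"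

definition is_strict_net ::
    "nat \<Rightarrow> (nat \<Rightarrow> 'a) \<Rightarrow> nat \<Rightarrow> nat \<Rightarrow> nat \<Rightarrow> nat \<Rightarrow> (nat \<Rightarrow> nat \<Rightarrow> 'a) set \<Rightarrow> bool" where
  "is_strict_net b \<phi> t m s n P \<longleftrightarrow>
     is_net b t m s (to_point b \<phi> s n ` P) \<and>
     (\<forall>t'. is_net b t' m s (to_point b \<phi> s n ` P) \<longrightarrow> t \<le> t')"

end

theory Submission
  imports Defs "HOL-Algebra.Multiplicative_Group"
begin

text \<open>
  Every character of a subgroup of \<open>G\<close> extends to \<open>G\<close>, so characters separate points, and
  counting \<open>\<Sum>\<kappa>. \<Sum>x. \<kappa>(x)\<close> in two ways gives \<open>#G\<^sup>* = #G\<close>. Hence \<open>\<Sum>\<kappa>. \<kappa>(x)\<close> is \<open>#G\<close> times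
  the indicator of \<open>x = 0\<close>, and \<open>k \<bullet> x\<close> summed over all \<open>k\<close> with \<open>\<mu>(k) \<le> a\<close> is \<open>b\<^sup>a\<close> if
  \<open>x\<close> starts with \<open>a\<close> zeros and \<open>0\<close> otherwise. Taking differences in \<open>a\<close> shows that
  \<open>p(\<mu>\<^sup>*(x); z) = \<Sum>k. z^\<mu>(k) (k \<bullet> x)\<close>. The identity for the weight enumerator follows by detecting
  \<open>P\<^sup>\<bottom>\<close> with \<open>\<Sum>X\<in>P. K \<bullet> X\<close> and exchanging the summations.

  For the nets, a point lies in an elementary interval with exponents \<open>d\<^sub>1, \<dots>, d\<^sub>s\<close> iff the first
  \<open>d\<^sub>i\<close> entries of the \<open>i\<close>-th row are prescribed. If \<open>P\<^sup>\<bottom>\<close> has no nonzero \<open>K\<close> with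
  \<open>\<mu>(k\<^sub>i) \<le> d\<^sub>i\<close> for all \<open>i\<close>, then Fourier inversion shows that all these fibres have the same
  cardinality; conversely such a \<open>K\<close> takes a value different from \<open>1\<close> on some fibre, which
  therefore contains no point of \<open>P\<close>. The same count with \<open>\<Sum>d\<^sub>i = m + 1\<close> yields the
  Singleton bound \<open>min \<le> m + 1\<close>, i.e. \<open>t \<ge> 0\<close>.
\<close>

subsection \<open>Characters of finite abelian groups\<close>

lemma in_hom_circle_iff:
  "\<chi> \<in> hom G circle_group \<longleftrightarrow>
     (\<forall>x\<in>carrier G. cmod (\<chi> x) = 1) \<and>
     (\<forall>x\<in>carrier G. \<forall>y\<in>carrier G. \<chi> (x \<otimes>\<^bsub>G\<^esub> y) = \<chi> x * \<chi> y)"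
  by (auto simp: hom_def circle_group_def)

lemma carrier_dual_group:
  "carrier (dual_group G) = hom G circle_group \<inter> extensional (carrier G)"
  and one_dual_group: "\<one>\<^bsub>dual_group G\<^esub> = (\<lambda>x\<in>carrier G. 1)"
  by (simp_all add: dual_group_def)

text \<open>Translation by some \<open>y\<close> in \<open>P\<close> with
  \<open>\<chi> y \<noteq> 1\<close> permutes \<open>P\<close> and multiplies the sum by
  \<open>\<chi> y\<close>, which forces the sum to vanish. The character lives on \<open>P\<close>
  alone, so the result serves both \<open>G\<close> and subgroups of the matrix group.\<close>

lemma (in group) sum_subgroup_character:
  assumes P: "subgroup P G" and \<chi>: "\<chi> \<in> hom (G\<lparr>carrier := P\<rparr>) circle_group"
  shows "(\<Sum>x\<in>P. \<chi> x) = (if \<forall>x\<in>P. \<chi> x = 1 then of_nat (card P) else 0)"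
proof (cases "\<forall>x\<in>P. \<chi> x = 1")
  case False
  interpret P: subgroup P G by fact
  obtain y where y: "y \<in> P" "\<chi> y \<noteq> 1" using False by blast
  have bij: "bij_betw (\<lambda>x. y \<otimes> x) P P"
    using y by (intro bij_betwI[where g = "\<lambda>x. inv y \<otimes> x"]) (auto simp: m_assoc[symmetric])
  have "(\<Sum>x\<in>P. \<chi> x) = (\<Sum>x\<in>P. \<chi> (y \<otimes> x))"
    by (rule sum.reindex_bij_betw[OF bij, symmetric])
  also have "\<dots> = \<chi> y * (\<Sum>x\<in>P. \<chi> x)"
    using \<chi> y by (auto simp: in_hom_circle_iff sum_distrib_left)
  finally show ?thesis using False y by (metis mult_cancel_right1)
qed simp

locale finite_comm_group = comm_group G for G (structure) +
  assumes finite_carrier: "finite (carrier G)"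
begin

lemma circle_hom_one:
  assumes "subgroup H G" "\<chi> \<in> hom (G\<lparr>carrier := H\<rparr>) circle_group"
  shows "\<chi> \<one> = 1"
proof -
  have 1: "\<one> \<in> H" using assms(1) subgroup.one_closed by blast
  have \<chi>: "\<forall>x\<in>H. cmod (\<chi> x) = 1" "\<forall>x\<in>H. \<forall>y\<in>H. \<chi> (x \<otimes> y) = \<chi> x * \<chi> y"
    using assms(2) by (auto simp: in_hom_circle_iff)
  have "cmod (\<chi> \<one>) = 1" "\<chi> (\<one> \<otimes> \<one>) = \<chi> \<one> * \<chi> \<one>"
    using \<chi> 1 by blast+
  then show ?thesis by (metis l_one mult_cancel_right1 norm_zero one_closed zero_neq_one)
qed

lemma circle_hom_pow:
  assumes "subgroup H G" "\<chi> \<in> hom (G\<lparr>carrier := H\<rparr>) circle_group" "x \<in> H"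
  shows "\<chi> (x [^] (k::nat)) = \<chi> x ^ k"
proof (induction k)
  case 0
  then show ?case using circle_hom_one[OF assms(1,2)] by simp
next
  case (Suc k)
  interpret H: subgroup H G by fact
  have "x [^] k \<in> H" using assms(3) by (induction k) auto
  then show ?case using Suc assms(2,3) by (auto simp: in_hom_circle_iff)
qed

text \<open>
  Here \<open>r\<close> is the order of \<open>a\<close> modulo \<open>H\<close>; the extension sends \<open>h \<otimes> a [^] k\<close> to \<open>\<chi> h * w ^ k\<close>.
  The freedom in the choice of the root \<open>w\<close> is what makes characters separate points.
\<close>

lemma extend_character_step:
  assumes H: "subgroup H G" and \<chi>: "\<chi> \<in> hom (G\<lparr>carrier := H\<rparr>) circle_group"
    and a: "a \<in> carrier G" and r: "r > 0" "a [^] (r::nat) \<in> H"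
    and least: "\<And>k. 0 < k \<Longrightarrow> k < r \<Longrightarrow> a [^] (k::nat) \<notin> H"
    and w: "w ^ r = \<chi> (a [^] r)"
  obtains H' \<chi>' where "subgroup H' G" "H \<subseteq> H'" "a \<in> H'"
    "\<chi>' \<in> hom (G\<lparr>carrier := H'\<rparr>) circle_group" "\<And>h. h \<in> H \<Longrightarrow> \<chi>' h = \<chi> h" "\<chi>' a = w"
proof -
  interpret H: subgroup H G by fact
  have \<chi>m: "\<chi> (x \<otimes> y) = \<chi> x * \<chi> y" if "x \<in> H" "y \<in> H" for x y
    using \<chi> that by (auto simp: in_hom_circle_iff)
  have \<chi>n: "cmod (\<chi> x) = 1" if "x \<in> H" for x
    using \<chi> that by (auto simp: in_hom_circle_iff)
  have "cmod w ^ r = 1" using w \<chi>n[OF r(2)] by (metis norm_power)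
  then have wn: "cmod w = 1"
    using power_eq_iff_eq_base[OF r(1), of "cmod w" 1] by simp
  have pow_in: "x [^] k \<in> H" if "x \<in> H" for x and k :: nat
    using that by (induction k) auto
  have Hcl: "x \<in> carrier G" if "x \<in> H" for x using that by auto
  \<comment> \<open>Division with remainder: the power of \<open>a\<close> with exponent
    \<open>d mod r\<close> again lies in \<open>H\<close>, so the minimality of \<open>r\<close>
    makes the remainder 0.\<close>
  have dvd: "r dvd d" if "a [^] d \<in> H" for d :: nat
  proof -
    have "a [^] d = a [^] (d div r * r + d mod r)" by simp
    also have "\<dots> = (a [^] r) [^] (d div r) \<otimes> a [^] (d mod r)"
      using a by (metis mult.commute nat_pow_mult nat_pow_pow)
    finally have e: "a [^] d = (a [^] r) [^] (d div r) \<otimes> a [^] (d mod r)" .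
    have c: "(a [^] r) [^] (d div r) \<in> H"
      using r(2) pow_in by blast
    have "a [^] (d mod r) = inv ((a [^] r) [^] (d div r)) \<otimes> a [^] d"
      by (rule iffD2[OF inv_solve_left]) (use a in simp_all, rule e)
    then have "a [^] (d mod r) \<in> H" using c that by auto
    then have "d mod r = 0" using least[of "d mod r"] r(1) by fastforce
    then show ?thesis by auto
  qed
  \<comment> \<open>On powers of \<open>a\<close> that already lie in \<open>H\<close> the old and
    the new prescription agree. This is the compatibility behind the well-definedness in
    \<open>wd0\<close>.\<close>
  have wp: "\<chi> (a [^] d) = w ^ d" if "a [^] d \<in> H" for d :: nat
  proof -
    obtain q where q: "d = r * q" using dvd[OF \<open>a [^] d \<in> H\<close>] by (auto elim: dvdE)
    have "a [^] d = (a [^] r) [^] q" using a q by (simp add: nat_pow_pow)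
    then show ?thesis using circle_hom_pow[OF H \<chi> r(2), of q] w q by (simp add: power_mult)
  qed
  have wd0: "\<chi> h * w ^ k = \<chi> h' * w ^ l"
    if "h \<in> H" "h' \<in> H" "k \<le> l" "h \<otimes> a [^] k = h' \<otimes> a [^] l" for h h' and k l :: nat
  proof -
    have "h' \<otimes> a [^] l = (h' \<otimes> a [^] (l - k)) \<otimes> a [^] k"
      using a that Hcl by (simp add: m_assoc nat_pow_mult)
    then have h: "h = h' \<otimes> a [^] (l - k)"
      using that a Hcl by (metis m_closed nat_pow_closed right_cancel)
    then have "a [^] (l - k) = inv h' \<otimes> h"
      using a that Hcl by (simp add: inv_solve_left)
    then have "a [^] (l - k) \<in> H" using that by auto
    then have "\<chi> h = \<chi> h' * w ^ (l - k)" using h \<chi>m that wp by simp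
    then show ?thesis using \<open>k \<le> l\<close> by (simp add: power_add[symmetric])
  qed
  then have wd: "\<chi> h * w ^ k = \<chi> h' * w ^ l"
    if "h \<in> H" "h' \<in> H" "h \<otimes> a [^] k = h' \<otimes> a [^] l" for h h' and k l :: nat
    using that by (metis nat_le_linear)
  define H' where "H' = {h \<otimes> a [^] k | h (k::nat). h \<in> H}"
  \<comment> \<open>The value is picked from an arbitrary representation
    \<open>h \<otimes> a [^] k\<close>; by \<open>wd\<close> all representations of the same element
    yield the same value.\<close>
  define \<chi>' where
    "\<chi>' x = (SOME v. \<exists>h (k::nat). h \<in> H \<and> x = h \<otimes> a [^] k \<and> v = \<chi> h * w ^ k)" for x
  have \<chi>': "\<chi>' (h \<otimes> a [^] k) = \<chi> h * w ^ k" if "h \<in> H" for h and k :: nat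
    unfolding \<chi>'_def
  proof (rule some_equality)
    show "v = \<chi> h * w ^ k"
      if "\<exists>h' l. h' \<in> H \<and> h \<otimes> a [^] k = h' \<otimes> a [^] (l::nat) \<and> v = \<chi> h' * w ^ l" for v
      using that wd[OF \<open>h \<in> H\<close>] by force
  qed (use that in blast)
  have mult: "(h \<otimes> a [^] k) \<otimes> (h' \<otimes> a [^] l) = (h \<otimes> h') \<otimes> a [^] (k + l)"
    if "h \<in> H" "h' \<in> H" for h h' and k l :: nat
    using a that Hcl by (simp add: nat_pow_mult[symmetric] m_ac)
  have sub: "subgroup H' G"
  proof
    show "H' \<subseteq> carrier G" using a Hcl by (auto simp: H'_def)
    show "x \<otimes> y \<in> H'" if "x \<in> H'" "y \<in> H'" for x y
      using that mult unfolding H'_def by (smt (verit) H.m_closed mem_Collect_eq)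
    show "\<one> \<in> H'"
    proof -
      have "\<one> = \<one> \<otimes> a [^] (0::nat)" by simp
      then show ?thesis unfolding H'_def using H.one_closed by blast
    qed
    show "inv x \<in> H'" if "x \<in> H'" for x
    proof -
      obtain h k where x: "x = h \<otimes> a [^] (k::nat)" "h \<in> H"
        using \<open>x \<in> H'\<close> unfolding H'_def by blast
      \<comment> \<open>Since \<open>a\<close> has finite order, \<open>a [^] (order G - 1)\<close>
        is its inverse, so natural exponents suffice to make \<open>H'\<close> closed under
        inverses.\<close>
      have o: "order G > 0" using finite_carrier order_gt_0_iff_finite by blast
      have "x \<otimes> (inv h \<otimes> a [^] (k * (order G - 1))) = (h \<otimes> inv h) \<otimes> a [^] (k * order G)"
        using x mult[of h "inv h" k "k * (order G - 1)"] o
        by (simp add: algebra_simps)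
      also have "a [^] (k * order G) = \<one>"
        using a pow_order_eq_1[of "a [^] k"] by (simp add: nat_pow_pow)
      finally have "inv x = inv h \<otimes> a [^] (k * (order G - 1))"
        using x a Hcl by (intro inv_equality) (auto simp: m_comm)
      then show ?thesis using x by (auto simp: H'_def)
    qed
  qed
  show thesis
  proof (rule that[of H' \<chi>'])
    show "H \<subseteq> H'"
    proof
      fix h assume "h \<in> H"
      then have "h = h \<otimes> a [^] (0::nat)" using Hcl by simp
      then show "h \<in> H'" unfolding H'_def using \<open>h \<in> H\<close> by blast
    qed
    have "a = \<one> \<otimes> a [^] (1::nat)" using a by simp
    then show "a \<in> H'" unfolding H'_def using H.one_closed by blast
    show "\<chi>' h = \<chi> h" if "h \<in> H" for h using \<chi>'[OF that, of 0] Hcl that by simp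
    show "\<chi>' a = w" using \<chi>'[OF H.one_closed, of 1] a circle_hom_one[OF H \<chi>] by simp
    show "\<chi>' \<in> hom (G\<lparr>carrier := H'\<rparr>) circle_group"
      by (auto simp: in_hom_circle_iff H'_def \<chi>' norm_mult norm_power \<chi>n wn mult \<chi>m power_add)
  qed (fact sub)
qed

text \<open>Induction on the number of elements outside \<open>H\<close>: adjoining one missing
  element shrinks the complement.\<close>

lemma extend_character:
  assumes "subgroup H G" "\<chi> \<in> hom (G\<lparr>carrier := H\<rparr>) circle_group"
  obtains \<kappa> where "\<kappa> \<in> hom G circle_group" "\<And>h. h \<in> H \<Longrightarrow> \<kappa> h = \<chi> h"
proof -
  have "\<exists>\<kappa>\<in>hom G circle_group. \<forall>h\<in>H. \<kappa> h = \<chi> h"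
    using assms
  proof (induction "card (carrier G - H)" arbitrary: H \<chi> rule: less_induct)
    case less
    show ?case
    proof (cases "H = carrier G")
      case True
      then show ?thesis using less.prems by auto
    next
      case False
      interpret H: subgroup H G by fact
      obtain a where a: "a \<in> carrier G" "a \<notin> H" using False H.subset by blast
      define r where "r = (LEAST k. 0 < k \<and> a [^] (k::nat) \<in> H)"
      have "0 < order G \<and> a [^] order G \<in> H"
        using a pow_order_eq_1 finite_carrier order_gt_0_iff_finite by auto
      then have r: "0 < r" "a [^] r \<in> H"
        unfolding r_def by (metis (mono_tags, lifting) LeastI)+
      have least: "a [^] k \<notin> H" if "0 < k" "k < r" for k
        using that not_less_Least unfolding r_def by blast
      have "cmod (\<chi> (a [^] r)) = 1" using less.prems r(2) by (auto simp: in_hom_circle_iff)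
      \<comment> \<open>A nonzero complex number has exactly \<open>r\<close> roots of degree
        \<open>r > 0\<close>, in particular at least one.\<close>
      obtain w where w: "w ^ r = \<chi> (a [^] r)"
      proof -
        have "\<chi> (a [^] r) \<noteq> 0" using \<open>cmod (\<chi> (a [^] r)) = 1\<close> by auto
        then have "card {w. w ^ r = \<chi> (a [^] r)} = r" using r(1) by (rule card_nth_roots)
        then have "{w. w ^ r = \<chi> (a [^] r)} \<noteq> {}" using r(1) by (metis card.empty less_irrefl)
        then show thesis using that by blast
      qed
      obtain H' \<chi>' where H': "subgroup H' G" "H \<subseteq> H'" "a \<in> H'"
        "\<chi>' \<in> hom (G\<lparr>carrier := H'\<rparr>) circle_group" "\<And>h. h \<in> H \<Longrightarrow> \<chi>' h = \<chi> h"
        using extend_character_step[OF less.prems a(1) r least w] by metis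
      have "card (carrier G - H') < card (carrier G - H)"
        using H' a finite_carrier by (intro psubset_card_mono) auto
      then obtain \<kappa> where "\<kappa> \<in> hom G circle_group" "\<forall>h\<in>H'. \<kappa> h = \<chi>' h"
        using less.hyps H' by blast
      then show ?thesis using H' by (metis subsetD)
    qed
  qed
  then show thesis using that by blast
qed

text \<open>The trivial character of the trivial subgroup is extended so that \<open>x\<close> is
  sent to a root of unity \<open>w \<noteq> 1\<close>. Such a \<open>w\<close> exists because the
  order \<open>r\<close> of \<open>x\<close> exceeds 1 and there are \<open>r\<close> roots of unity
  of degree \<open>r\<close>.\<close>

lemma characters_separate_points:
  assumes x: "x \<in> carrier G" "x \<noteq> \<one>"
  obtains \<kappa> where "\<kappa> \<in> carrier (dual_group G)" "\<kappa> x \<noteq> 1"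
proof -
  define r where "r = (LEAST k. 0 < k \<and> x [^] (k::nat) \<in> {\<one>})"
  have "0 < order G \<and> x [^] order G \<in> {\<one>}"
    using x pow_order_eq_1 finite_carrier order_gt_0_iff_finite by auto
  then have r: "0 < r" "x [^] r \<in> {\<one>}"
    unfolding r_def by (metis (mono_tags, lifting) LeastI)+
  have least: "x [^] k \<notin> {\<one>}" if "0 < k" "k < r" for k
    using that not_less_Least unfolding r_def by blast
  have "r \<noteq> 1" using r x by auto
  then have "card {w::complex. w ^ r = 1} > 1"
    using r by (subst card_roots_unity_eq) auto
  then have "\<not> {w::complex. w ^ r = 1} \<subseteq> {1}"
    by (metis card_mono card.empty card_insert_disjoint finite.intros empty_iff One_nat_def not_less)
  then obtain w :: complex where w: "w ^ r = 1" "w \<noteq> 1" by blast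
  have triv: "(\<lambda>_. 1) \<in> hom (G\<lparr>carrier := {\<one>}\<rparr>) circle_group"
    by (auto simp: in_hom_circle_iff)
  obtain H' \<chi>' where H': "subgroup H' G" "x \<in> H'"
    "\<chi>' \<in> hom (G\<lparr>carrier := H'\<rparr>) circle_group" "\<chi>' x = w"
    using extend_character_step[OF triv_subgroup triv x(1) r least, of w] w by metis
  obtain \<kappa> where \<kappa>: "\<kappa> \<in> hom G circle_group" "\<And>h. h \<in> H' \<Longrightarrow> \<kappa> h = \<chi>' h"
    using extend_character[OF H'(1,3)] by blast
  show thesis
  proof
    show "restrict \<kappa> (carrier G) \<in> carrier (dual_group G)"
      using \<kappa> by (auto simp: carrier_dual_group in_hom_circle_iff)
    show "restrict \<kappa> (carrier G) x \<noteq> 1" using \<kappa> H' w x by simp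
  qed
qed

section \<open>Size of the dual group and orthogonality over characters\<close>

lemma dual_group_at_one:
  "\<kappa> \<in> carrier (dual_group G) \<Longrightarrow> \<kappa> \<one> = 1"
  by (rule circle_hom_one[OF subgroup_self]) (simp add: carrier_dual_group)

text \<open>Every value of a character is a root of unity of degree \<open>order G\<close>, and
  extensionality leaves no freedom outside the carrier.\<close>

lemma finite_dual_group: "finite (carrier (dual_group G))"
proof -
  have "carrier (dual_group G) \<subseteq> (\<Pi>\<^sub>E x\<in>carrier G. {w::complex. w ^ order G = 1})"
  proof
    fix \<kappa> assume \<kappa>: "\<kappa> \<in> carrier (dual_group G)"
    then have hom: "\<kappa> \<in> hom (G\<lparr>carrier := carrier G\<rparr>) circle_group"
      by (simp add: carrier_dual_group)
    have "\<kappa> x ^ order G = 1" if "x \<in> carrier G" for x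
      using circle_hom_pow[OF subgroup_self hom that, of "order G"] that
        circle_hom_one[OF subgroup_self hom] by (simp add: pow_order_eq_1)
    then show "\<kappa> \<in> (\<Pi>\<^sub>E x\<in>carrier G. {w. w ^ order G = 1})"
      using \<kappa> by (auto simp: carrier_dual_group PiE_iff)
  qed
  moreover have "order G > 0" using finite_carrier order_gt_0_iff_finite by blast
  ultimately show ?thesis
    by (elim finite_subset) (auto intro!: finite_PiE finite_carrier finite_roots_unity)
qed

lemma one_in_dual_group: "\<one>\<^bsub>dual_group G\<^esub> \<in> carrier (dual_group G)"
  by (auto simp: carrier_dual_group one_dual_group in_hom_circle_iff)

text \<open>Multiplication by a character \<open>\<rho>\<close> with
  \<open>\<rho> x \<noteq> 1\<close> permutes the dual group and scales the sum by
  \<open>\<rho> x\<close>.\<close>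

lemma sum_dual_group_nontrivial:
  assumes x: "x \<in> carrier G" "x \<noteq> \<one>"
  shows "(\<Sum>\<kappa>\<in>carrier (dual_group G). \<kappa> x) = 0"
proof -
  obtain \<rho> where \<rho>: "\<rho> \<in> carrier (dual_group G)" "\<rho> x \<noteq> 1"
    using characters_separate_points[OF x] by blast
  let ?f = "\<lambda>\<kappa>. \<lambda>y\<in>carrier G. \<rho> y * \<kappa> y" and ?g = "\<lambda>\<kappa>. \<lambda>y\<in>carrier G. inverse (\<rho> y) * \<kappa> y"
  have nz: "\<rho> y \<noteq> 0" if "y \<in> carrier G" for y
    using \<rho> that by (fastforce simp: carrier_dual_group in_hom_circle_iff)
  have bij: "bij_betw ?f (carrier (dual_group G)) (carrier (dual_group G))"
  proof (rule bij_betwI[where g = ?g])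
    show "?f \<in> carrier (dual_group G) \<rightarrow> carrier (dual_group G)"
      using \<rho> by (auto simp: carrier_dual_group in_hom_circle_iff norm_mult)
    show "?g \<in> carrier (dual_group G) \<rightarrow> carrier (dual_group G)"
      using \<rho> by (auto simp: carrier_dual_group in_hom_circle_iff norm_mult norm_inverse)
    show "?g (?f \<kappa>) = \<kappa>" if "\<kappa> \<in> carrier (dual_group G)" for \<kappa>
      using that nz by (auto simp: carrier_dual_group extensional_def fun_eq_iff)
    show "?f (?g \<kappa>) = \<kappa>" if "\<kappa> \<in> carrier (dual_group G)" for \<kappa>
      using that nz by (auto simp: carrier_dual_group extensional_def fun_eq_iff)
  qed
  have "(\<Sum>\<kappa>\<in>carrier (dual_group G). \<kappa> x) = (\<Sum>\<kappa>\<in>carrier (dual_group G). ?f \<kappa> x)"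
    by (rule sum.reindex_bij_betw[OF bij, symmetric])
  also have "\<dots> = \<rho> x * (\<Sum>\<kappa>\<in>carrier (dual_group G). \<kappa> x)"
    using x by (simp add: sum_distrib_left)
  finally show ?thesis using \<rho> by (metis mult_cancel_right1)
qed

text \<open>In the double sum over characters and elements, summing over characters first leaves
  only \<open>\<one>\<close>, and summing over elements first leaves only the trivial
  character.\<close>

lemma card_dual_group: "card (carrier (dual_group G)) = order G"
proof -
  let ?D = "carrier (dual_group G)"
  have hom: "\<kappa> \<in> hom (G\<lparr>carrier := carrier G\<rparr>) circle_group" if "\<kappa> \<in> ?D" for \<kappa>
    using that by (simp add: carrier_dual_group)
  have triv: "(\<forall>x\<in>carrier G. \<kappa> x = 1) \<longleftrightarrow> \<kappa> = \<one>\<^bsub>dual_group G\<^esub>" if "\<kappa> \<in> ?D" for \<kappa>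
    using that by (auto simp: carrier_dual_group one_dual_group extensional_def fun_eq_iff)
  have "(of_nat (card ?D) :: complex) = (\<Sum>\<kappa>\<in>?D. 1)" by simp
  also have "\<dots> = (\<Sum>\<kappa>\<in>?D. \<kappa> \<one>)"
    by (intro sum.cong refl) (simp add: dual_group_at_one)
  also have "\<dots> = (\<Sum>x\<in>{\<one>}. \<Sum>\<kappa>\<in>?D. \<kappa> x)" by simp
  also have "\<dots> = (\<Sum>x\<in>carrier G. \<Sum>\<kappa>\<in>?D. \<kappa> x)"
    using sum_dual_group_nontrivial finite_carrier by (intro sum.mono_neutral_left) auto
  also have "\<dots> = (\<Sum>\<kappa>\<in>?D. \<Sum>x\<in>carrier G. \<kappa> x)" by (rule sum.swap)
  also have "\<dots> = (\<Sum>\<kappa>\<in>?D. if \<kappa> = \<one>\<^bsub>dual_group G\<^esub> then of_nat (order G) else 0)"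
    using sum_subgroup_character[OF subgroup_self hom] triv
    by (intro sum.cong refl) (simp add: order_def)
  also have "\<dots> = of_nat (order G)"
    using one_in_dual_group finite_dual_group by simp
  finally show ?thesis using of_nat_eq_iff by blast
qed

lemma sum_dual_group:
  assumes "x \<in> carrier G"
  shows "(\<Sum>\<kappa>\<in>carrier (dual_group G). \<kappa> x) = (if x = \<one> then of_nat (order G) else 0)"
proof (cases "x = \<one>")
  case True
  have "(\<Sum>\<kappa>\<in>carrier (dual_group G). \<kappa> \<one>) = (\<Sum>\<kappa>\<in>carrier (dual_group G). 1)"
    by (intro sum.cong refl) (simp add: dual_group_at_one)
  then show ?thesis using True card_dual_group by simp
qed (use assms sum_dual_group_nontrivial in auto)

end

subsection \<open>Matrix groups and weights\<close>

lemma carrier_row_group: "carrier (row_group H n) = ({1..n} \<rightarrow>\<^sub>E carrier H)"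
  and one_row_group: "\<one>\<^bsub>row_group H n\<^esub> = (\<lambda>j\<in>{1..n}. \<one>\<^bsub>H\<^esub>)"
  by (simp_all add: row_group_def)

lemma carrier_matrix_group:
  "carrier (matrix_group H s n) = ({1..s} \<rightarrow>\<^sub>E carrier (row_group H n))"
  and one_matrix_group:
  "\<one>\<^bsub>matrix_group H s n\<^esub> = (\<lambda>i\<in>{1..s}. \<one>\<^bsub>row_group H n\<^esub>)"
  by (simp_all add: matrix_group_def)

lemma matrix_entry:
  "X \<in> carrier (matrix_group H s n) \<Longrightarrow> i \<in> {1..s} \<Longrightarrow> j \<in> {1..n} \<Longrightarrow> X i j \<in> carrier H"
  by (fastforce simp: carrier_matrix_group carrier_row_group PiE_iff)

lemma matrix_row:
  "X \<in> carrier (matrix_group H s n) \<Longrightarrow> i \<in> {1..s} \<Longrightarrow> X i \<in> carrier (row_group H n)"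
  by (auto simp: carrier_matrix_group PiE_iff)

lemma mult_matrix_entry:
  "i \<in> {1..s} \<Longrightarrow> j \<in> {1..n} \<Longrightarrow> (X \<otimes>\<^bsub>matrix_group H s n\<^esub> Y) i j = X i j \<otimes>\<^bsub>H\<^esub> Y i j"
  by (simp add: matrix_group_def row_group_def)

lemma group_matrix_group: "group H \<Longrightarrow> group (matrix_group H s n)"
  by (simp add: matrix_group_def row_group_def)

lemma inv_matrix_entry:
  assumes "group H" "X \<in> carrier (matrix_group H s n)" "i \<in> {1..s}" "j \<in> {1..n}"
  shows "(inv\<^bsub>matrix_group H s n\<^esub> X) i j = inv\<^bsub>H\<^esub> (X i j)"
proof -
  have "X i \<in> (\<Pi>\<^sub>E j\<in>{1..n}. carrier H)"
    using matrix_row[OF assms(2,3)] by (simp add: carrier_row_group)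
  then have "inv\<^bsub>product_group {1..n} (\<lambda>_. H)\<^esub> (X i) = (\<lambda>j\<in>{1..n}. inv\<^bsub>H\<^esub> (X i j))"
    using assms(1) by (intro inv_product_group)
  moreover have "inv\<^bsub>matrix_group H s n\<^esub> X = (\<lambda>i\<in>{1..s}. inv\<^bsub>row_group H n\<^esub> (X i))"
    unfolding matrix_group_def using assms
    by (intro inv_product_group) (auto simp: carrier_matrix_group row_group_def)
  ultimately show ?thesis using assms(3,4) by (simp add: row_group_def)
qed

lemma row_eq_one_iff:
  assumes "k \<in> carrier (row_group H n)"
  shows "k = \<one>\<^bsub>row_group H n\<^esub> \<longleftrightarrow> (\<forall>j\<in>{1..n}. k j = \<one>\<^bsub>H\<^esub>)"
  using assms by (auto simp: carrier_row_group one_row_group PiE_iff extensional_def fun_eq_iff)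

lemma matrix_eq_one_iff:
  assumes "K \<in> carrier (matrix_group H s n)"
  shows "K = \<one>\<^bsub>matrix_group H s n\<^esub> \<longleftrightarrow> (\<forall>i\<in>{1..s}. \<forall>j\<in>{1..n}. K i j = \<one>\<^bsub>H\<^esub>)"
proof -
  have "K = \<one>\<^bsub>matrix_group H s n\<^esub> \<longleftrightarrow> (\<forall>i\<in>{1..s}. K i = \<one>\<^bsub>row_group H n\<^esub>)"
    using assms by (auto simp: carrier_matrix_group one_matrix_group PiE_iff extensional_def fun_eq_iff)
  then show ?thesis using row_eq_one_iff[OF matrix_row[OF assms]] by simp
qed

text \<open>This is the form in which the weight enters the sums: a ball of the weight restricts
  each entry separately, so sums over it factor.\<close>

lemma nrt_weight_le_iff:
  assumes "k \<in> carrier (row_group H n)"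
  shows "nrt_weight H n k \<le> a \<longleftrightarrow> (\<forall>j\<in>{1..n}. a < j \<longrightarrow> k j = \<one>\<^bsub>H\<^esub>)"
proof (cases "k = \<one>\<^bsub>row_group H n\<^esub>")
  case True
  then show ?thesis using row_eq_one_iff[OF assms] by (simp add: nrt_weight_def)
next
  case False
  then have "{j \<in> {1..n}. k j \<noteq> \<one>\<^bsub>H\<^esub>} \<noteq> {}" using row_eq_one_iff[OF assms] by auto
  then have "Max {j \<in> {1..n}. k j \<noteq> \<one>\<^bsub>H\<^esub>} \<le> a \<longleftrightarrow> (\<forall>j\<in>{j \<in> {1..n}. k j \<noteq> \<one>\<^bsub>H\<^esub>}. j \<le> a)"
    by (intro Max_le_iff) auto
  also have "\<dots> \<longleftrightarrow> (\<forall>j\<in>{1..n}. a < j \<longrightarrow> k j = \<one>\<^bsub>H\<^esub>)"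
    by (auto simp del: atLeastAtMost_iff simp flip: not_le)
  finally show ?thesis using False by (simp add: nrt_weight_def)
qed

lemma nrt_weight_le: "k \<in> carrier (row_group H n) \<Longrightarrow> nrt_weight H n k \<le> n"
  by (simp add: nrt_weight_le_iff)

lemma nrt_weight_eq_0_iff:
  "k \<in> carrier (row_group H n) \<Longrightarrow> nrt_weight H n k = 0 \<longleftrightarrow> k = \<one>\<^bsub>row_group H n\<^esub>"
  using nrt_weight_le_iff[of k H n 0] row_eq_one_iff[of k H n] by auto

lemma matrix_weight_le:
  assumes "K \<in> carrier (matrix_group H s n)"
  shows "matrix_weight H s n K \<le> n * s"
proof -
  have "(\<Sum>i=1..s. nrt_weight H n (K i)) \<le> (\<Sum>i=1..s. n)"
    using nrt_weight_le[OF matrix_row[OF assms]] by (intro sum_mono) auto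
  then show ?thesis by (simp add: matrix_weight_def mult.commute)
qed

lemma matrix_weight_eq_0_iff:
  assumes "K \<in> carrier (matrix_group H s n)"
  shows "matrix_weight H s n K = 0 \<longleftrightarrow> K = \<one>\<^bsub>matrix_group H s n\<^esub>"
proof -
  have "matrix_weight H s n K = 0 \<longleftrightarrow> (\<forall>i\<in>{1..s}. K i = \<one>\<^bsub>row_group H n\<^esub>)"
    using nrt_weight_eq_0_iff[OF matrix_row[OF assms]] by (simp add: matrix_weight_def)
  then show ?thesis
    using matrix_eq_one_iff[OF assms] row_eq_one_iff[OF matrix_row[OF assms]] by simp
qed

text \<open>The value 0 given to the zero row acts as infinity, because that row starts with any
  number of zeros; hence the separate disjunct.\<close>

lemma less_dual_nrt_weight_iff:
  assumes "x \<in> carrier (row_group H n)"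
  shows "(\<forall>j\<in>{1..n}. j \<le> a \<longrightarrow> x j = \<one>\<^bsub>H\<^esub>) \<longleftrightarrow>
    dual_nrt_weight H n x = 0 \<or> a < dual_nrt_weight H n x"
proof (cases "x = \<one>\<^bsub>row_group H n\<^esub>")
  case True
  then show ?thesis using row_eq_one_iff[OF assms] by (simp add: dual_nrt_weight_def)
next
  case False
  let ?S = "{j \<in> {1..n}. x j \<noteq> \<one>\<^bsub>H\<^esub>}"
  have S: "?S \<noteq> {}" using False row_eq_one_iff[OF assms] by auto
  then have less: "c < Min ?S \<longleftrightarrow> (\<forall>j\<in>?S. c < j)" for c by (intro Min_gr_iff) auto
  have "0 < Min ?S" unfolding less by auto
  moreover have "(\<forall>j\<in>{1..n}. j \<le> a \<longrightarrow> x j = \<one>\<^bsub>H\<^esub>) \<longleftrightarrow> a < Min ?S"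
    unfolding less by (auto simp del: atLeastAtMost_iff simp flip: not_le)
  ultimately show ?thesis using False by (simp add: dual_nrt_weight_def)
qed

lemma dual_nrt_weight_le:
  assumes "x \<in> carrier (row_group H n)"
  shows "dual_nrt_weight H n x \<le> n"
proof (cases "x = \<one>\<^bsub>row_group H n\<^esub>")
  case True
  then show ?thesis by (simp add: dual_nrt_weight_def)
next
  case False
  then have "\<not> (\<forall>j\<in>{1..n}. j \<le> n \<longrightarrow> x j = \<one>\<^bsub>H\<^esub>)"
    using row_eq_one_iff[OF assms] by simp
  then show ?thesis using less_dual_nrt_weight_iff[OF assms, of n] by linarith
qed

subsection \<open>Weight enumerator\<close>

context finite_comm_group
begin

lemma finite_row_group: "finite (carrier (row_group (dual_group G) n))"
  by (auto simp: carrier_row_group intro!: finite_PiE finite_dual_group)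

lemma finite_matrix_group: "finite (carrier (matrix_group (dual_group G) s n))"
  by (auto simp: carrier_matrix_group intro!: finite_PiE finite_row_group)

text \<open>The ball is a product of full dual groups in the first \<open>a\<close> places and
  trivial groups in the others. The sum is therefore a product of sums over single entries, each
  known by orthogonality.\<close>

lemma sum_row_le_weight:
  assumes "a \<le> n" and x: "x \<in> carrier (row_group G n)"
  shows "(\<Sum>k\<in>{k \<in> carrier (row_group (dual_group G) n). nrt_weight (dual_group G) n k \<le> a}.
            \<Prod>j=1..n. k j (x j)) =
         (if \<forall>j\<in>{1..n}. j \<le> a \<longrightarrow> x j = \<one> then of_nat (order G) ^ a else 0)"
proof -
  let ?D = "dual_group G"
  let ?B = "\<lambda>j. if j \<le> a then carrier ?D else {\<one>\<^bsub>?D\<^esub>}"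
  have xj: "x j \<in> carrier G" if "j \<in> {1..n}" for j
    using x that by (auto simp: carrier_row_group)
  have "{k \<in> carrier (row_group ?D n). nrt_weight ?D n k \<le> a} = PiE {1..n} ?B"
    (is "?L = ?R")
  proof (intro equalityI subsetI)
    fix k assume "k \<in> ?L"
    then show "k \<in> ?R" using nrt_weight_le_iff[of k ?D n a]
      by (auto simp: carrier_row_group PiE_iff)
  next
    fix k assume k: "k \<in> ?R"
    then have kB: "k j \<in> ?B j" if "j \<in> {1..n}" for j using that by (rule PiE_mem)
    have "k j \<in> carrier ?D" if "j \<in> {1..n}" for j
      using kB[OF that] one_in_dual_group by (auto split: if_splits)
    then have "k \<in> carrier (row_group ?D n)" using k by (auto simp: carrier_row_group PiE_iff)
    then show "k \<in> ?L" using k nrt_weight_le_iff[of k ?D n a] by (auto simp: PiE_iff)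
  qed
  then have "(\<Sum>k\<in>?L. \<Prod>j=1..n. k j (x j)) = (\<Sum>k\<in>PiE {1..n} ?B. \<Prod>j=1..n. k j (x j))"
    by simp
  also have "\<dots> = (\<Prod>j=1..n. \<Sum>\<kappa>\<in>?B j. \<kappa> (x j))"
    using finite_dual_group by (intro prod_sum_PiE[symmetric]) auto
  also have "\<dots> = (\<Prod>j=1..n. if j \<le> a then if x j = \<one> then of_nat (order G) else 0 else 1)"
    using xj by (intro prod.cong refl) (simp add: sum_dual_group one_dual_group)
  also have "\<dots> = (if \<forall>j\<in>{1..n}. j \<le> a \<longrightarrow> x j = \<one> then of_nat (order G) ^ a else 0)"
  proof (cases "\<forall>j\<in>{1..n}. j \<le> a \<longrightarrow> x j = \<one>")
    case True
    have "{1..n} \<inter> {j. j \<le> a} = {1..a}" using assms(1) by auto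
    moreover have "(\<Prod>j=1..n. if j \<le> a then if x j = \<one> then of_nat (order G) else 0 else 1) =
      (\<Prod>j=1..n. if j \<le> a then of_nat (order G) else (1::complex))"
      using True by (intro prod.cong) auto
    ultimately show ?thesis using True by (simp add: prod.If_cases)
  next
    case False
    then obtain j where "j \<in> {1..n}" "j \<le> a" "x j \<noteq> \<one>" by blast
    then show ?thesis unfolding if_not_P[OF False] by (intro prod_zero) auto
  qed
  finally show ?thesis .
qed

lemma sum_row_weighted:
  assumes x: "x \<in> carrier (row_group G n)"
  shows "(\<Sum>k\<in>carrier (row_group (dual_group G) n).
            z ^ nrt_weight (dual_group G) n k * (\<Prod>j=1..n. k j (x j))) =
         p_poly (order G) n (dual_nrt_weight G n x) z"
proof -
  let ?D = "dual_group G"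
  let ?R = "carrier (row_group ?D n)" and ?\<mu> = "nrt_weight ?D n"
  define h where "h = dual_nrt_weight G n x"
  define e where "e k = (\<Prod>j=1..n. k j (x j))" for k :: "nat \<Rightarrow> 'a \<Rightarrow> complex"
  \<comment> \<open>\<open>T\<close> sums over a sphere and \<open>S\<close> over a ball. The balls
    have closed formulas, and the spheres are obtained as differences of consecutive balls.\<close>
  define T where "T a = (\<Sum>k\<in>{k \<in> ?R. ?\<mu> k = a}. e k)" for a
  define S where "S a = (\<Sum>k\<in>{k \<in> ?R. ?\<mu> k \<le> a}. e k)" for a
  have S: "S a = (if h = 0 \<or> a < h then of_nat (order G) ^ a else 0)" if "a \<le> n" for a
    using sum_row_le_weight[OF that x] less_dual_nrt_weight_iff[OF x, of a]
    by (simp add: S_def h_def e_def)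
  have T: "T a = S a - S (a - 1)" if "a \<in> {1..n}" for a
  proof -
    have "{k \<in> ?R. ?\<mu> k \<le> a} = {k \<in> ?R. ?\<mu> k \<le> a - 1} \<union> {k \<in> ?R. ?\<mu> k = a}"
      using that by auto
    then have "S a = S (a - 1) + T a"
      using that finite_row_group[of n] unfolding S_def T_def
      by (subst sum.union_disjoint[symmetric]) auto
    then show ?thesis by simp
  qed
  have "T 0 = S 0" by (simp add: S_def T_def)
  then have T0: "T 0 = 1" using S[of 0] by auto
  have "(\<Sum>k\<in>?R. z ^ ?\<mu> k * e k) = (\<Sum>a\<in>{0..n}. \<Sum>k\<in>{k \<in> ?R. ?\<mu> k = a}. z ^ ?\<mu> k * e k)"
    using finite_row_group[of n] nrt_weight_le by (intro sum.group[symmetric]) auto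
  also have "\<dots> = (\<Sum>a\<in>{0..n}. z ^ a * T a)"
    by (intro sum.cong refl) (simp add: T_def sum_distrib_left)
  also have "\<dots> = 1 + (\<Sum>a=1..n. z ^ a * (S a - S (a - 1)))"
    using T0 T by (simp add: sum.atLeast_Suc_atMost)
  also have "\<dots> = p_poly (order G) n h z"
  proof (cases "h = 0")
    case True
    then have "(\<Sum>a=1..n. z ^ a * (S a - S (a - 1))) =
      (\<Sum>a=1..n. z ^ a * (of_nat (order G) ^ a - of_nat (order G) ^ (a - 1)))"
      by (intro sum.cong) (auto simp: S)
    then show ?thesis using True by (simp add: p_poly_def)
  next
    case False
    have h: "h \<le> n" unfolding h_def by (rule dual_nrt_weight_le[OF x])
    \<comment> \<open>Balls of radius \<open>h\<close> or more sum to 0, so nothing remains beyond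
      \<open>h\<close>. At \<open>h\<close> itself \<open>S h = 0\<close>, which produces the
      negative last term of \<open>p_poly\<close>.\<close>
    have "(\<Sum>a=1..n. z ^ a * (S a - S (a - 1))) = (\<Sum>a=1..h. z ^ a * (S a - S (a - 1)))"
      using h False S by (intro sum.mono_neutral_right) auto
    also have "{1..h} = insert h {1..h - 1}" using False by auto
    also have "(\<Sum>a\<in>insert h {1..h - 1}. z ^ a * (S a - S (a - 1))) =
      z ^ h * (S h - S (h - 1)) + (\<Sum>a=1..h - 1. z ^ a * (S a - S (a - 1)))"
      using False by (intro sum.insert) auto
    also have "(\<Sum>a=1..h - 1. z ^ a * (S a - S (a - 1))) =
      (\<Sum>a=1..h - 1. z ^ a * (of_nat (order G) ^ a - of_nat (order G) ^ (a - 1)))"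
    proof (intro sum.cong refl)
      fix a assume "a \<in> {1..h - 1}"
      then have "a < h" "a - 1 < h" "a \<le> n" "a - 1 \<le> n" using h by auto
      then show "z ^ a * (S a - S (a - 1)) =
          z ^ a * (of_nat (order G) ^ a - of_nat (order G) ^ (a - 1))"
        by (simp add: S)
    qed
    finally show ?thesis using S[of h] S[of "h - 1"] h False by (simp add: p_poly_def)
  qed
  finally show ?thesis by (simp add: e_def h_def)
qed

lemma pairing_mult:
  assumes "K \<in> carrier (matrix_group (dual_group G) s n)"
    and "X \<in> carrier (matrix_group G s n)" "Y \<in> carrier (matrix_group G s n)"
  shows "pairing s n K (X \<otimes>\<^bsub>matrix_group G s n\<^esub> Y) = pairing s n K X * pairing s n K Y"
proof -
  have "K i j (X i j \<otimes> Y i j) = K i j (X i j) * K i j (Y i j)" if "i \<in> {1..s}" "j \<in> {1..n}" for i j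
    using matrix_entry[OF assms(1) that] matrix_entry[OF assms(2) that] matrix_entry[OF assms(3) that]
    by (simp add: carrier_dual_group in_hom_circle_iff)
  then show ?thesis
    unfolding pairing_def prod.distrib[symmetric]
    by (intro prod.cong refl) (simp only: mult_matrix_entry)
qed

lemma norm_pairing:
  assumes "K \<in> carrier (matrix_group (dual_group G) s n)" "X \<in> carrier (matrix_group G s n)"
  shows "cmod (pairing s n K X) = 1"
proof -
  have "cmod (K i j (X i j)) = 1" if "i \<in> {1..s}" "j \<in> {1..n}" for i j
    using matrix_entry[OF assms(1) that] matrix_entry[OF assms(2) that]
    by (simp add: carrier_dual_group in_hom_circle_iff)
  then show ?thesis unfolding pairing_def prod_norm[symmetric] by (intro prod.neutral ballI)
qed

text \<open>Pairing with \<open>K\<close> is a character of \<open>P\<close>, trivial exactly when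
  \<open>K\<close> lies in \<open>perp\<close>; the sum thus detects membership in
  \<open>perp\<close>.\<close>

lemma sum_pairing_subgroup:
  assumes P: "subgroup P (matrix_group G s n)"
    and K: "K \<in> carrier (matrix_group (dual_group G) s n)"
  shows "(\<Sum>X\<in>P. pairing s n K X) = (if K \<in> perp G s n P then of_nat (card P) else 0)"
proof -
  interpret M: group "matrix_group G s n" by (rule group_matrix_group) (rule is_group)
  have "pairing s n K \<in> hom (matrix_group G s n\<lparr>carrier := P\<rparr>) circle_group"
    using subgroup.subset[OF P] pairing_mult[OF K] norm_pairing[OF K]
    by (auto simp: in_hom_circle_iff subset_iff)
  from M.sum_subgroup_character[OF P this] show ?thesis using K by (simp add: perp_def)
qed

lemma finite_perp: "finite (perp G s n P)"
  using finite_matrix_group by (rule finite_subset[rotated]) (auto simp: perp_def)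

lemma weight_enumerator:
  assumes P: "subgroup P (matrix_group G s n)"
  shows "(\<Sum>a=0..n * s. of_nat (weight_count G s n P a) * z ^ a) =
    1 / of_nat (card P) *
      (\<Sum>X\<in>P. \<Prod>i=1..s. p_poly (order G) n (dual_nrt_weight G n (X i)) z)"
proof -
  let ?D = "dual_group G"
  let ?M = "carrier (matrix_group ?D s n)" and ?\<mu> = "matrix_weight ?D s n"
  have PM: "P \<subseteq> carrier (matrix_group G s n)" using P by (rule subgroup.subset)
  have "finite (carrier (matrix_group G s n))"
    by (auto simp: carrier_matrix_group carrier_row_group intro!: finite_PiE finite_carrier)
  then have "finite P" "P \<noteq> {}" using PM subgroup.one_closed[OF P] finite_subset by auto
  then have cP: "(of_nat (card P) :: complex) \<noteq> 0" by simp
  have "(\<Sum>a=0..n * s. of_nat (weight_count G s n P a) * z ^ a) =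
    (\<Sum>a\<in>{0..n * s}. \<Sum>K\<in>{K \<in> perp G s n P. ?\<mu> K = a}. z ^ ?\<mu> K)"
    by (simp add: weight_count_def)
  also have "\<dots> = (\<Sum>K\<in>perp G s n P. z ^ ?\<mu> K)"
    using finite_perp matrix_weight_le by (intro sum.group) (auto simp: perp_def)
  also have "\<dots> = (\<Sum>K\<in>?M. if K \<in> perp G s n P then z ^ ?\<mu> K else 0)"
    using finite_matrix_group
    by (subst sum.inter_filter[symmetric]) (auto simp: perp_def intro!: sum.cong)
  \<comment> \<open>Multiplying by \<open>card P\<close> turns the indicator of \<open>perp\<close>
    into the sum of the pairing over \<open>P\<close>, so that the two summations can be
    exchanged.\<close>
  finally have "of_nat (card P) * (\<Sum>a=0..n * s. of_nat (weight_count G s n P a) * z ^ a) =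
    (\<Sum>K\<in>?M. z ^ ?\<mu> K * (\<Sum>X\<in>P. pairing s n K X))"
    using sum_pairing_subgroup[OF P]
    by (auto simp: sum_distrib_left intro!: sum.cong)
  also have "\<dots> = (\<Sum>X\<in>P. \<Sum>K\<in>?M. z ^ ?\<mu> K * pairing s n K X)"
    unfolding sum_distrib_left by (rule sum.swap)
  also have "\<dots> = (\<Sum>X\<in>P. \<Prod>i=1..s. p_poly (order G) n (dual_nrt_weight G n (X i)) z)"
  proof (intro sum.cong refl)
    fix X assume "X \<in> P"
    then have X: "X \<in> carrier (matrix_group G s n)" using PM by auto
    have "(\<Sum>K\<in>?M. z ^ ?\<mu> K * pairing s n K X) =
      (\<Sum>K\<in>?M. \<Prod>i=1..s. z ^ nrt_weight ?D n (K i) * (\<Prod>j=1..n. K i j (X i j)))"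
      by (simp add: matrix_weight_def pairing_def power_sum prod.distrib)
    \<comment> \<open>Weight and pairing are both multiplicative over rows after exponentiation, and
      the rows of \<open>K\<close> vary independently.\<close>
    also have "\<dots> = (\<Prod>i=1..s. \<Sum>k\<in>carrier (row_group ?D n).
        z ^ nrt_weight ?D n k * (\<Prod>j=1..n. k j (X i j)))"
      unfolding carrier_matrix_group using finite_row_group by (subst prod_sum_PiE) auto
    also have "\<dots> = (\<Prod>i=1..s. p_poly (order G) n (dual_nrt_weight G n (X i)) z)"
      using sum_row_weighted matrix_row[OF X] by (intro prod.cong) auto
    finally show "(\<Sum>K\<in>?M. z ^ ?\<mu> K * pairing s n K X) = \<dots>" .
  qed
  finally show ?thesis using cP by (simp add: field_simps)
qed

section \<open>Equidistribution of a subgroup over fibres with prescribed leading entries\<close>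

text \<open>The admissible \<open>K\<close> form a product of balls, one for each row, so the row
  formula is multiplied over the rows.\<close>

lemma sum_pairing_box:
  assumes X: "X \<in> carrier (matrix_group G s n)" and d: "\<And>i. i \<in> {1..s} \<Longrightarrow> d i \<le> n"
  shows "(\<Sum>K\<in>{K \<in> carrier (matrix_group (dual_group G) s n).
               \<forall>i\<in>{1..s}. nrt_weight (dual_group G) n (K i) \<le> d i}. pairing s n K X) =
    (if \<forall>i\<in>{1..s}. \<forall>j\<in>{1..n}. j \<le> d i \<longrightarrow> X i j = \<one>
     then of_nat (order G) ^ (\<Sum>i=1..s. d i) else 0)"
proof -
  let ?D = "dual_group G"
  let ?B = "\<lambda>i. {k \<in> carrier (row_group ?D n). nrt_weight ?D n k \<le> d i}"
  have "{K \<in> carrier (matrix_group ?D s n). \<forall>i\<in>{1..s}. nrt_weight ?D n (K i) \<le> d i} =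
    PiE {1..s} ?B"
    unfolding carrier_matrix_group PiE_def Pi_def by blast
  then have "(\<Sum>K\<in>{K \<in> carrier (matrix_group ?D s n).
      \<forall>i\<in>{1..s}. nrt_weight ?D n (K i) \<le> d i}. pairing s n K X) =
    (\<Prod>i=1..s. \<Sum>k\<in>?B i. \<Prod>j=1..n. k j (X i j))"
    using finite_row_group unfolding pairing_def by (subst prod_sum_PiE) auto
  also have "\<dots> = (\<Prod>i=1..s. if \<forall>j\<in>{1..n}. j \<le> d i \<longrightarrow> X i j = \<one>
      then of_nat (order G) ^ d i else 0)"
    using d matrix_row[OF X] by (intro prod.cong refl sum_row_le_weight) auto
  also have "\<dots> = (if \<forall>i\<in>{1..s}. \<forall>j\<in>{1..n}. j \<le> d i \<longrightarrow> X i j = \<one>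
     then of_nat (order G) ^ (\<Sum>i=1..s. d i) else 0)"
  proof (cases "\<forall>i\<in>{1..s}. \<forall>j\<in>{1..n}. j \<le> d i \<longrightarrow> X i j = \<one>")
    case True
    then show ?thesis by (auto simp: power_sum intro!: prod.cong)
  next
    case False
    then obtain i where i: "i \<in> {1..s}" "\<not> (\<forall>j\<in>{1..n}. j \<le> d i \<longrightarrow> X i j = \<one>)" by blast
    then show ?thesis unfolding if_not_P[OF False] by (intro prod_zero) auto
  qed
  finally show ?thesis .
qed

text \<open>Fourier inversion: up to the factor \<open>order G ^ (\<Sum>i=1..s. d i)\<close>,
  agreement of \<open>X\<close> with \<open>Y\<close> on the leading entries is indicated by the
  sum, over the box of all \<open>K\<close> with row weights at most \<open>d i\<close>, of the
  pairing of \<open>K\<close> with the quotient of \<open>X\<close> by \<open>Y\<close>. Summing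
  over \<open>P\<close> first leaves only the part of the box in \<open>perp\<close>, which
  \<open>triv\<close> reduces to the unit.\<close>

lemma card_fibre:
  assumes P: "subgroup P (matrix_group G s n)"
    and Y: "Y \<in> carrier (matrix_group G s n)"
    and d: "\<And>i. i \<in> {1..s} \<Longrightarrow> d i \<le> n"
    and triv: "\<And>K. K \<in> perp G s n P \<Longrightarrow>
      (\<And>i. i \<in> {1..s} \<Longrightarrow> nrt_weight (dual_group G) n (K i) \<le> d i) \<Longrightarrow>
      K = \<one>\<^bsub>matrix_group (dual_group G) s n\<^esub>"
  shows "order G ^ (\<Sum>i=1..s. d i) *
      card {X \<in> P. \<forall>i\<in>{1..s}. \<forall>j\<in>{1..n}. j \<le> d i \<longrightarrow> X i j = Y i j} = card P"
proof -
  let ?D = "dual_group G" and ?M = "matrix_group G s n"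
  let ?I = "\<one>\<^bsub>matrix_group ?D s n\<^esub>"
  let ?B = "{K \<in> carrier (matrix_group ?D s n). \<forall>i\<in>{1..s}. nrt_weight ?D n (K i) \<le> d i}"
  let ?A = "{X \<in> P. \<forall>i\<in>{1..s}. \<forall>j\<in>{1..n}. j \<le> d i \<longrightarrow> X i j = Y i j}"
  interpret M: group ?M by (rule group_matrix_group) (rule is_group)
  have PM: "P \<subseteq> carrier ?M" using P by (rule subgroup.subset)
  have "finite (carrier ?M)"
    by (auto simp: carrier_matrix_group carrier_row_group intro!: finite_PiE finite_carrier)
  then have fin: "finite P" using PM finite_subset by auto
  have iY: "inv\<^bsub>?M\<^esub> Y \<in> carrier ?M" using Y by simp
  have one: "?I \<in> carrier (matrix_group ?D s n)"
    using one_in_dual_group by (auto simp: one_matrix_group carrier_matrix_group one_row_group carrier_row_group)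
  have one_pair: "pairing s n ?I X = 1" if "X \<in> carrier ?M" for X
    using matrix_entry[OF that]
    unfolding pairing_def
    by (intro prod.neutral ballI) (simp add: one_matrix_group one_row_group one_dual_group)
  have one_perp: "?I \<in> perp G s n P" using one one_pair PM by (auto simp: perp_def)
  have "nrt_weight ?D n (?I i) = 0" if "i \<in> {1..s}" for i
    using that by (simp add: one_matrix_group nrt_weight_def)
  then have one_B: "?I \<in> ?B" using one by simp
  have agree: "(\<forall>i\<in>{1..s}. \<forall>j\<in>{1..n}. j \<le> d i \<longrightarrow> (X \<otimes>\<^bsub>?M\<^esub> inv\<^bsub>?M\<^esub> Y) i j = \<one>) \<longleftrightarrow>
    (\<forall>i\<in>{1..s}. \<forall>j\<in>{1..n}. j \<le> d i \<longrightarrow> X i j = Y i j)" if "X \<in> P" for X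
  proof -
    have "(X \<otimes>\<^bsub>?M\<^esub> inv\<^bsub>?M\<^esub> Y) i j = \<one> \<longleftrightarrow> X i j = Y i j" if "i \<in> {1..s}" "j \<in> {1..n}" for i j
    proof -
      have c: "X i j \<in> carrier G" "Y i j \<in> carrier G"
        using that PM \<open>X \<in> P\<close> Y by (auto intro: matrix_entry)
      then have "X i j \<otimes> inv (Y i j) = \<one> \<longleftrightarrow> X i j = Y i j"
        by (metis inv_solve_right' l_one one_closed r_inv)
      then show ?thesis using that Y by (simp add: mult_matrix_entry inv_matrix_entry is_group)
    qed
    then show ?thesis by blast
  qed
  have "(of_nat (order G ^ (\<Sum>i=1..s. d i) * card ?A) :: complex) =
    (\<Sum>X\<in>?A. of_nat (order G) ^ (\<Sum>i=1..s. d i))" by simp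
  also have "\<dots> = (\<Sum>X\<in>P. if \<forall>i\<in>{1..s}. \<forall>j\<in>{1..n}. j \<le> d i \<longrightarrow> X i j = Y i j
       then of_nat (order G) ^ (\<Sum>i=1..s. d i) else 0)"
    using fin by (rule sum.inter_filter)
  also have "\<dots> = (\<Sum>X\<in>P. \<Sum>K\<in>?B. pairing s n K (X \<otimes>\<^bsub>?M\<^esub> inv\<^bsub>?M\<^esub> Y))"
    using PM iY d agree by (intro sum.cong refl) (subst sum_pairing_box; auto)
  also have "\<dots> = (\<Sum>X\<in>P. \<Sum>K\<in>?B. pairing s n K (inv\<^bsub>?M\<^esub> Y) * pairing s n K X)"
    using PM iY by (intro sum.cong refl) (auto simp: pairing_mult)
  also have "\<dots> = (\<Sum>K\<in>?B. \<Sum>X\<in>P. pairing s n K (inv\<^bsub>?M\<^esub> Y) * pairing s n K X)"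
    by (rule sum.swap)
  also have "\<dots> = (\<Sum>K\<in>?B. pairing s n K (inv\<^bsub>?M\<^esub> Y) *
      (if K \<in> perp G s n P then of_nat (card P) else 0))"
    using sum_pairing_subgroup[OF P] by (simp add: sum_distrib_left[symmetric])
  \<comment> \<open>By \<open>triv\<close> every other \<open>K\<close> in the box lies outside
    \<open>perp\<close> and contributes 0.\<close>
  also have "\<dots> = (\<Sum>K\<in>{?I}. pairing s n K (inv\<^bsub>?M\<^esub> Y) *
      (if K \<in> perp G s n P then of_nat (card P) else 0))"
    using finite_matrix_group[of s n] one_B triv by (intro sum.mono_neutral_right) auto
  also have "\<dots> = of_nat (card P)" using one_perp one_pair[OF iY] by simp
  finally show ?thesis by (simp only: of_nat_eq_iff)
qed

end

subsection \<open>Digits and nets\<close>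

text \<open>Horner evaluation of base-\<open>b\<close> digits \<open>c 1, ..., c d\<close> with
  \<open>c 1\<close> the most significant. Working with this integer turns questions about real
  intervals into questions about \<open>div\<close>.\<close>

primrec digit_value :: "nat \<Rightarrow> (nat \<Rightarrow> nat) \<Rightarrow> nat \<Rightarrow> nat" where
  "digit_value b c 0 = 0"
| "digit_value b c (Suc d) = b * digit_value b c d + c (Suc d)"

lemma digit_value_less:
  assumes "\<And>j. j \<in> {1..d} \<Longrightarrow> c j < b"
  shows "digit_value b c d < b ^ d"
  using assms
proof (induction d)
  case (Suc d)
  then have "digit_value b c d < b ^ d" "c (Suc d) < b" by auto
  then have "b * digit_value b c d + c (Suc d) < b * (digit_value b c d + 1)" by simp
  also have "\<dots> \<le> b * b ^ d" using \<open>digit_value b c d < b ^ d\<close> by (intro mult_le_mono) auto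
  finally show ?case by simp
qed simp

text \<open>Division by \<open>b\<close> drops the last digit, as that digit is smaller than
  \<open>b\<close>; this is iterated \<open>n - d\<close> times.\<close>

lemma digit_value_div:
  assumes "\<And>j. j \<in> {1..n} \<Longrightarrow> c j < b" "d \<le> n"
  shows "digit_value b c n div b ^ (n - d) = digit_value b c d"
  using assms
proof (induction n)
  case (Suc n)
  show ?case
  proof (cases "d = Suc n")
    case False
    then have d: "d \<le> n" using Suc.prems by simp
    have "c (Suc n) < b" using Suc.prems by simp
    then have "digit_value b c (Suc n) div b = digit_value b c n" by simp
    then have "digit_value b c (Suc n) div b ^ (Suc n - d) = digit_value b c n div b ^ (n - d)"
      using d by (simp add: Suc_diff_le div_mult2_eq del: digit_value.simps)
    then show ?thesis using Suc d by simp
  qed simp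
qed simp

lemma digit_value_eq_iff:
  assumes "\<And>j. j \<in> {1..d} \<Longrightarrow> c j < b" "\<And>j. j \<in> {1..d} \<Longrightarrow> c' j < b"
  shows "digit_value b c d = digit_value b c' d \<longleftrightarrow> (\<forall>j\<in>{1..d}. c j = c' j)"
  using assms
proof (induction d)
  case (Suc d)
  have c: "c (Suc d) < b" "c' (Suc d) < b" using Suc.prems by auto
  have "digit_value b c (Suc d) = digit_value b c' (Suc d) \<longleftrightarrow>
    digit_value b c d = digit_value b c' d \<and> c (Suc d) = c' (Suc d)"
  proof
    assume e: "digit_value b c (Suc d) = digit_value b c' (Suc d)"
    from arg_cong[OF e, of "\<lambda>v. v div b"] arg_cong[OF e, of "\<lambda>v. v mod b"]
    show "digit_value b c d = digit_value b c' d \<and> c (Suc d) = c' (Suc d)" using c by simp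
  qed simp
  also have "\<dots> \<longleftrightarrow> (\<forall>j\<in>{1..Suc d}. c j = c' j)"
    using Suc by (auto simp: atLeastAtMostSuc_conv)
  finally show ?case .
qed simp

text \<open>The digits are bounded at all indices, also beyond \<open>d\<close>, so that
  \<open>c\<close> can fill a whole row of a matrix.\<close>

lemma digit_value_surj:
  assumes "b > 0" "a < b ^ d"
  shows "\<exists>c. (\<forall>j. c j < b) \<and> digit_value b c d = a"
  using assms(2)
proof (induction d arbitrary: a)
  case 0
  then show ?case using assms(1) by (intro exI[of _ "\<lambda>_. 0"]) simp
next
  case (Suc d)
  have "a div b < b ^ d" using Suc.prems by (simp add: less_mult_imp_div_less mult.commute)
  then obtain c where c: "\<forall>j. c j < b" "digit_value b c d = a div b" using Suc.IH by blast
  let ?c = "c(Suc d := a mod b)"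
  have lt: "\<forall>j. ?c j < b" using c assms(1) by simp
  then have "digit_value b ?c d = digit_value b c d" using c by (subst digit_value_eq_iff) auto
  then have "digit_value b ?c (Suc d) = a" using c by simp
  then show ?case using lt by blast
qed

lemma sum_digits_eq:
  assumes "b > 0"
  shows "(\<Sum>j=1..n. real (c j) / real b ^ j) = real (digit_value b c n) / real b ^ n"
  using assms by (induction n) (auto simp: field_simps)

text \<open>Scaled by \<open>b ^ n\<close>, the interval consists of the values from
  \<open>a * b ^ (n - d)\<close> up to, but not including,
  \<open>Suc a * b ^ (n - d)\<close>.\<close>

lemma in_elementary_interval_iff:
  fixes a b d n v :: nat
  assumes "b > 0" "d \<le> n"
  shows "real v / real b ^ n \<in> {real a / real b ^ d ..< (real a + 1) / real b ^ d} \<longleftrightarrow>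
    v div b ^ (n - d) = a"
proof -
  have n: "real b ^ n = real b ^ d * real b ^ (n - d)"
    using assms(2) by (simp add: power_add[symmetric])
  have "real a / real b ^ d \<le> real v / real b ^ n \<longleftrightarrow> real (a * b ^ (n - d)) \<le> real v"
    using assms(1) unfolding n by (simp add: field_simps)
  moreover have "real v / real b ^ n < (real a + 1) / real b ^ d \<longleftrightarrow>
      real v < real (Suc a * b ^ (n - d))"
    using assms(1) unfolding n by (simp add: field_simps)
  moreover have "a * b ^ (n - d) \<le> v \<and> v < Suc a * b ^ (n - d) \<longleftrightarrow> v div b ^ (n - d) = a"
  proof -
    have "b ^ (n - d) > 0" using assms(1) by simp
    then show ?thesis
      by (metis div_less_iff_less_mult less_Suc_eq_le less_eq_div_iff_mult_less_eq order_antisym_conv order_refl)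
  qed
  ultimately show ?thesis unfolding of_nat_le_iff of_nat_less_iff by simp
qed

section \<open>Minimum weight and the Singleton bound\<close>

text \<open>Supplies row depths for the Singleton bound. The choice is greedy: the last row takes
  \<open>min M n\<close>, and the remainder fits into the other rows.\<close>

lemma exists_bounded_sum:
  fixes M n s :: nat
  assumes "M \<le> n * s"
  shows "\<exists>d. (\<forall>i. d i \<le> n) \<and> (\<Sum>i=1..s. d i) = M"
  using assms
proof (induction s arbitrary: M)
  case 0
  then show ?case by (intro exI[of _ "\<lambda>_. 0"]) simp
next
  case (Suc s)
  have "M - min M n \<le> n * s" using Suc.prems by auto
  then obtain d where d: "\<forall>i. d i \<le> n" "(\<Sum>i=1..s. d i) = M - min M n" using Suc.IH by blast
  let ?d = "d(Suc s := min M n)"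
  have "(\<Sum>i=1..s. ?d i) = (\<Sum>i=1..s. d i)" by (intro sum.cong) auto
  then have "(\<Sum>i=1..Suc s. ?d i) = M" using d by simp
  moreover have "\<forall>i. ?d i \<le> n" using d by simp
  ultimately show ?case by blast
qed

lemma min_weight_bounds: "1 \<le> min_weight G s n P" "min_weight G s n P \<le> n * s + 1"
proof -
  let ?S = "{a \<in> {1..n * s}. weight_count G s n P a \<noteq> 0}"
  have "1 \<le> min_weight G s n P \<and> min_weight G s n P \<le> n * s + 1"
  proof (cases "?S = {}")
    case True
    then show ?thesis by (auto simp: min_weight_def)
  next
    case False
    then have "Min ?S \<in> ?S" by (intro Min_in) auto
    moreover have "min_weight G s n P = Min ?S" using False by (auto simp: min_weight_def)
    ultimately show ?thesis by auto
  qed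
  then show "1 \<le> min_weight G s n P" "min_weight G s n P \<le> n * s + 1" by auto
qed

context finite_comm_group
begin

text \<open>A nonzero \<open>K\<close> has weight between 1 and \<open>n * s\<close>, so its weight
  is among the values over which the minimum is taken and the default does not apply.\<close>

lemma min_weight_le:
  assumes K: "K \<in> perp G s n P" "K \<noteq> \<one>\<^bsub>matrix_group (dual_group G) s n\<^esub>"
  shows "min_weight G s n P \<le> matrix_weight (dual_group G) s n K"
proof -
  let ?w = "matrix_weight (dual_group G) s n K"
  have M: "K \<in> carrier (matrix_group (dual_group G) s n)" using K by (simp add: perp_def)
  have w: "?w \<in> {1..n * s}"
    using matrix_weight_le[OF M] matrix_weight_eq_0_iff[OF M] K(2) by (auto simp: Suc_le_eq)
  have "K \<in> {K' \<in> perp G s n P. matrix_weight (dual_group G) s n K' = ?w}" using K by simp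
  then have "weight_count G s n P ?w \<noteq> 0"
    using finite_perp[of s n P] unfolding weight_count_def card_eq_0_iff by force
  then show ?thesis using w by (auto simp: min_weight_def intro!: Min_le)
qed

lemma min_weight_attained:
  assumes "min_weight G s n P \<le> n * s"
  obtains K where "K \<in> perp G s n P"
    "matrix_weight (dual_group G) s n K = min_weight G s n P"
proof -
  let ?S = "{a \<in> {1..n * s}. weight_count G s n P a \<noteq> 0}"
  have ne: "?S \<noteq> {}" "min_weight G s n P = Min ?S"
    using assms by (auto simp: min_weight_def split: if_splits)
  have "Min ?S \<in> ?S" using ne(1) by (intro Min_in) auto
  then have "card {K \<in> perp G s n P. matrix_weight (dual_group G) s n K = min_weight G s n P} \<noteq> 0"
    unfolding ne(2)[symmetric] by (simp add: weight_count_def)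
  then show thesis using that by (metis (mono_tags, lifting) card.empty empty_Collect_eq)
qed

text \<open>Otherwise the fibre count for depths of total \<open>m + 1\<close> would make
  \<open>order G ^ (m + 1)\<close> divide \<open>order G ^ m\<close>.\<close>

lemma min_weight_le_Suc:
  assumes P: "subgroup P (matrix_group G s n)" and card: "card P = order G ^ m"
    and b: "order G \<ge> 2"
  shows "min_weight G s n P \<le> m + 1"
proof (rule ccontr)
  assume less: "\<not> min_weight G s n P \<le> m + 1"
  \<comment> \<open>Even the default value of \<open>min_weight\<close> is only
    \<open>n * s + 1\<close>, so the assumption leaves room for depths of total
    \<open>m + 1\<close>, each at most \<open>n\<close>.\<close>
  then have "m + 1 \<le> n * s" using min_weight_bounds(2)[of G s n P] by linarith
  then obtain d where d: "\<forall>i. d i \<le> n" "(\<Sum>i=1..s. d i) = m + 1"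
    using exists_bounded_sum by blast
  interpret M: group "matrix_group G s n" by (rule group_matrix_group) (rule is_group)
  have "order G ^ (\<Sum>i=1..s. d i) * card {X \<in> P. \<forall>i\<in>{1..s}. \<forall>j\<in>{1..n}. j \<le> d i \<longrightarrow>
      X i j = \<one>\<^bsub>matrix_group G s n\<^esub> i j} = card P"
  proof (rule card_fibre[OF P M.one_closed])
    show "K = \<one>\<^bsub>matrix_group (dual_group G) s n\<^esub>"
      if "K \<in> perp G s n P"
        "\<And>i. i \<in> {1..s} \<Longrightarrow> nrt_weight (dual_group G) n (K i) \<le> d i" for K
    proof (rule ccontr)
      assume "K \<noteq> \<one>\<^bsub>matrix_group (dual_group G) s n\<^esub>"
      with min_weight_le[OF that(1)] less have "m + 1 < matrix_weight (dual_group G) s n K"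
        by simp
      moreover have "matrix_weight (dual_group G) s n K \<le> (\<Sum>i=1..s. d i)"
        unfolding matrix_weight_def using that(2) by (intro sum_mono) auto
      ultimately show False using d by simp
    qed
  qed (use d in auto)
  then have "order G ^ (m + 1) dvd order G ^ m" unfolding d(2) card by (rule dvdI[OF sym])
  then show False using power_dvd_imp_le[of "order G" "m + 1" m] b by linarith
qed

section \<open>Points of the cube as digit expansions, and the net property\<close>

definition digits :: "(nat \<Rightarrow> 'a) \<Rightarrow> (nat \<Rightarrow> nat \<Rightarrow> 'a) \<Rightarrow> nat \<Rightarrow> nat \<Rightarrow> nat" where
  "digits \<phi> X i j = inv_into {..<order G} \<phi> (X i j)"

context
  fixes \<phi> :: "nat \<Rightarrow> 'a" and s n :: nat
  assumes \<phi>: "bij_betw \<phi> {..<order G} (carrier G)"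
begin

lemma order_pos: "order G > 0"
  using finite_carrier order_gt_0_iff_finite by blast

lemma digits_less:
  assumes "X \<in> carrier (matrix_group G s n)" "i \<in> {1..s}" "j \<in> {1..n}"
  shows "digits \<phi> X i j < order G"
  using inv_into_into[of "X i j" \<phi> "{..<order G}"] matrix_entry[OF assms] \<phi>
  by (auto simp: digits_def bij_betw_def)

lemma digits_eq_iff:
  assumes "X \<in> carrier (matrix_group G s n)" "Y \<in> carrier (matrix_group G s n)"
    and "i \<in> {1..s}" "j \<in> {1..n}"
  shows "digits \<phi> X i j = digits \<phi> Y i j \<longleftrightarrow> X i j = Y i j"
  using matrix_entry[OF assms(1,3,4)] matrix_entry[OF assms(2,3,4)] \<phi>
  unfolding digits_def bij_betw_def by (metis f_inv_into_f)

lemma digit_value_digits_eq_iff: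
  assumes X: "X \<in> carrier (matrix_group G s n)" and Y: "Y \<in> carrier (matrix_group G s n)"
    and i: "i \<in> {1..s}" and d: "d \<le> n"
  shows "digit_value (order G) (digits \<phi> X i) d = digit_value (order G) (digits \<phi> Y i) d \<longleftrightarrow>
    (\<forall>j\<in>{1..n}. j \<le> d \<longrightarrow> X i j = Y i j)"
proof -
  have "digit_value (order G) (digits \<phi> X i) d = digit_value (order G) (digits \<phi> Y i) d \<longleftrightarrow>
    (\<forall>j\<in>{1..d}. digits \<phi> X i j = digits \<phi> Y i j)"
    using d digits_less[OF X i] digits_less[OF Y i] by (intro digit_value_eq_iff) auto
  then show ?thesis using digits_eq_iff[OF X Y i] d by auto
qed

lemma to_point_eq:
  assumes "i \<in> {1..s}"
  shows "to_point (order G) \<phi> s n X i =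
    real (digit_value (order G) (digits \<phi> X i) n) / real (order G) ^ n"
  using assms sum_digits_eq[OF order_pos, of "digits \<phi> X i" n]
  by (simp add: to_point_def digits_def)

lemma to_point_in_interval_iff:
  assumes X: "X \<in> carrier (matrix_group G s n)" and i: "i \<in> {1..s}" and d: "d \<le> n"
  shows "to_point (order G) \<phi> s n X i \<in>
      {real a / real (order G) ^ d ..< (real a + 1) / real (order G) ^ d} \<longleftrightarrow>
    digit_value (order G) (digits \<phi> X i) d = a"
  unfolding to_point_eq[OF i] in_elementary_interval_iff[OF order_pos d]
  using digits_less[OF X i] d by (subst digit_value_div) auto

lemma to_point_in_cube:
  assumes X: "X \<in> carrier (matrix_group G s n)"
  shows "to_point (order G) \<phi> s n X \<in> {1..s} \<rightarrow>\<^sub>E {0..<1}"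
proof -
  have "to_point (order G) \<phi> s n X i \<in> {0..<1}" if i: "i \<in> {1..s}" for i
    \<comment> \<open>Depth 0 with \<open>a = 0\<close> describes the whole interval from 0 to 1,
      and the empty digit string has value 0.\<close>
    using to_point_in_interval_iff[OF X i, of 0 0] by simp
  then show ?thesis by (auto simp: to_point_def)
qed

lemma inj_on_to_point: "inj_on (to_point (order G) \<phi> s n) (carrier (matrix_group G s n))"
proof (rule inj_onI)
  fix X Y assume X: "X \<in> carrier (matrix_group G s n)" and Y: "Y \<in> carrier (matrix_group G s n)"
    and e: "to_point (order G) \<phi> s n X = to_point (order G) \<phi> s n Y"
  have "X i j = Y i j" if "i \<in> {1..s}" "j \<in> {1..n}" for i j
  proof -
    have "digit_value (order G) (digits \<phi> X i) n = digit_value (order G) (digits \<phi> Y i) n"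
      using fun_cong[OF e, of i] that(1) order_pos by (simp add: to_point_eq)
    then show ?thesis using digit_value_digits_eq_iff[OF X Y that(1)] that(2) by auto
  qed
  then have "X i = Y i" if "i \<in> {1..s}" for i
    using matrix_row[OF X that] matrix_row[OF Y that] that unfolding carrier_row_group
    by (intro PiE_ext) auto
  then show "X = Y" using X Y unfolding carrier_matrix_group by (intro PiE_ext) auto
qed

text \<open>The matrix \<open>Y\<close> encodes the interval: its leading digits are the
  base-\<open>b\<close> digits of the numbers \<open>a i\<close>. Injectivity of
  \<open>to_point\<close> transfers the count.\<close>

lemma card_points_in_interval:
  assumes P: "P \<subseteq> carrier (matrix_group G s n)" and Y: "Y \<in> carrier (matrix_group G s n)"
    and d: "\<And>i. i \<in> {1..s} \<Longrightarrow> d i \<le> n"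
    and a: "\<And>i. i \<in> {1..s} \<Longrightarrow> a i = digit_value (order G) (digits \<phi> Y i) (d i)"
  shows "card {x \<in> to_point (order G) \<phi> s n ` P. \<forall>i\<in>{1..s}.
      x i \<in> {real (a i) / real (order G) ^ d i ..< (real (a i) + 1) / real (order G) ^ d i}} =
    card {X \<in> P. \<forall>i\<in>{1..s}. \<forall>j\<in>{1..n}. j \<le> d i \<longrightarrow> X i j = Y i j}"
proof -
  let ?f = "to_point (order G) \<phi> s n"
  let ?I = "\<lambda>i. {real (a i) / real (order G) ^ d i ..< (real (a i) + 1) / real (order G) ^ d i}"
  let ?A = "{X \<in> P. \<forall>i\<in>{1..s}. \<forall>j\<in>{1..n}. j \<le> d i \<longrightarrow> X i j = Y i j}"
  have "(\<forall>i\<in>{1..s}. ?f X i \<in> ?I i) \<longleftrightarrow>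
      (\<forall>i\<in>{1..s}. \<forall>j\<in>{1..n}. j \<le> d i \<longrightarrow> X i j = Y i j)" if "X \<in> P" for X
  proof -
    have X: "X \<in> carrier (matrix_group G s n)" using that P by auto
    show ?thesis
    proof (intro ball_cong refl)
      fix i assume i: "i \<in> {1..s}"
      show "?f X i \<in> ?I i \<longleftrightarrow> (\<forall>j\<in>{1..n}. j \<le> d i \<longrightarrow> X i j = Y i j)"
        unfolding to_point_in_interval_iff[OF X i d[OF i]] a[OF i]
        by (rule digit_value_digits_eq_iff[OF X Y i d[OF i]])
    qed
  qed
  then have "{x \<in> ?f ` P. \<forall>i\<in>{1..s}. x i \<in> ?I i} = ?f ` ?A" by blast
  moreover have "inj_on ?f ?A" using inj_on_to_point by (rule inj_on_subset) (use P in auto)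
  ultimately show ?thesis by (simp add: card_image)
qed

text \<open>A matrix \<open>Y\<close> determines an elementary interval through its leading digits,
  and each elementary interval arises in this way. As \<open>m \<le> n\<close>, no depth exceeds
  \<open>n\<close>, so the \<open>n\<close> available digits resolve every interval.\<close>

lemma is_net_iff_fibres:
  assumes P: "P \<subseteq> carrier (matrix_group G s n)" and card: "card P = order G ^ m"
    and t: "t \<le> m" and m: "m \<le> n"
  shows "is_net (order G) t m s (to_point (order G) \<phi> s n ` P) \<longleftrightarrow>
    (\<forall>d. (\<Sum>i=1..s. d i) = m - t \<longrightarrow> (\<forall>Y\<in>carrier (matrix_group G s n).
      card {X \<in> P. \<forall>i\<in>{1..s}. \<forall>j\<in>{1..n}. j \<le> d i \<longrightarrow> X i j = Y i j} = order G ^ t))"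
    (is "?net \<longleftrightarrow> ?fib")
proof -
  let ?f = "to_point (order G) \<phi> s n" and ?b = "order G"
  let ?C = "\<lambda>d a. card {x \<in> ?f ` P. \<forall>i\<in>{1..s}.
      x i \<in> {real (a i) / real ?b ^ d i ..< (real (a i) + 1) / real ?b ^ d i}}"
  have d_le: "d i \<le> n" if "(\<Sum>i=1..s. d i) = m - t" "i \<in> {1..s}" for d :: "nat \<Rightarrow> nat" and i
    using member_le_sum[of i "{1..s}" d] that m by simp
  have "?net \<longleftrightarrow> (\<forall>d a :: nat \<Rightarrow> nat. (\<Sum>i=1..s. d i) = m - t \<longrightarrow>
      (\<forall>i\<in>{1..s}. a i < ?b ^ d i) \<longrightarrow> ?C d a = ?b ^ t)"
    using t to_point_in_cube P card card_image[OF inj_on_subset[OF inj_on_to_point P]]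
    by (auto simp: is_net_def)
  also have "\<dots> \<longleftrightarrow> ?fib"
  proof (intro iffI allI impI ballI)
    fix d Y
    assume net: "\<forall>d a :: nat \<Rightarrow> nat. (\<Sum>i=1..s. d i) = m - t \<longrightarrow>
      (\<forall>i\<in>{1..s}. a i < ?b ^ d i) \<longrightarrow> ?C d a = ?b ^ t"
    assume d: "(\<Sum>i=1..s. d i) = m - t" and Y: "Y \<in> carrier (matrix_group G s n)"
    define a where "a i = digit_value ?b (digits \<phi> Y i) (d i)" for i
    have "a i < ?b ^ d i" if "i \<in> {1..s}" for i
      unfolding a_def using digits_less[OF Y that] d_le[OF d that]
      by (intro digit_value_less) auto
    then have "?C d a = ?b ^ t" using net d by blast
    then show "card {X \<in> P. \<forall>i\<in>{1..s}. \<forall>j\<in>{1..n}. j \<le> d i \<longrightarrow> X i j = Y i j} = ?b ^ t"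
      using card_points_in_interval[OF P Y d_le[OF d], where a = a] a_def by simp
  next
    fix d a :: "nat \<Rightarrow> nat"
    assume fib: ?fib and d: "(\<Sum>i=1..s. d i) = m - t" and a: "\<forall>i\<in>{1..s}. a i < ?b ^ d i"
    have "\<forall>i\<in>{1..s}. \<exists>c. (\<forall>j. c j < ?b) \<and> digit_value ?b c (d i) = a i"
      using a digit_value_surj[OF order_pos] by blast
    then obtain c where c: "\<And>i j. i \<in> {1..s} \<Longrightarrow> c i j < ?b"
      "\<And>i. i \<in> {1..s} \<Longrightarrow> digit_value ?b (c i) (d i) = a i" by metis
    \<comment> \<open>Only the first \<open>d i\<close> digits of row \<open>i\<close> are forced by
      \<open>a i\<close>; the later ones are whatever \<open>c\<close> supplies.\<close>
    define Y where "Y = (\<lambda>i\<in>{1..s}. \<lambda>j\<in>{1..n}. \<phi> (c i j))"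
    have Y: "Y \<in> carrier (matrix_group G s n)"
      using c(1) bij_betwE[OF \<phi>] by (auto simp: Y_def carrier_matrix_group carrier_row_group)
    have dig: "digits \<phi> Y i j = c i j" if "i \<in> {1..s}" "j \<in> {1..n}" for i j
      using that c(1) \<phi> by (simp add: digits_def Y_def bij_betw_def inv_into_f_f)
    have "a i = digit_value ?b (digits \<phi> Y i) (d i)" if "i \<in> {1..s}" for i
    proof -
      have "digit_value ?b (digits \<phi> Y i) (d i) = digit_value ?b (c i) (d i)"
        using dig that c(1) d_le[OF d that] by (subst digit_value_eq_iff) auto
      then show ?thesis using c(2) that by simp
    qed
    then show "?C d a = ?b ^ t"
      using card_points_in_interval[OF P Y d_le[OF d], where a = a] fib d Y by simp
  qed
  finally show ?thesis .
qed

text \<open>Reduces the net property to a comparison with a single number, from which the least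
  admissible \<open>t\<close> can be read off.\<close>

lemma is_net_iff_min_weight:
  assumes P: "subgroup P (matrix_group G s n)" and card: "card P = order G ^ m"
    and t: "t \<le> m" and m: "m \<le> n" and s: "s \<ge> 1"
  shows "is_net (order G) t m s (to_point (order G) \<phi> s n ` P) \<longleftrightarrow>
    m - t < min_weight G s n P"
proof -
  let ?D = "dual_group G" and ?b = "order G"
  let ?A = "\<lambda>d Y. {X \<in> P. \<forall>i\<in>{1..s}. \<forall>j\<in>{1..n}. j \<le> d i \<longrightarrow> X i j = Y i j}"
  have PM: "P \<subseteq> carrier (matrix_group G s n)" using P by (rule subgroup.subset)
  show ?thesis
    unfolding is_net_iff_fibres[OF PM card t m]
  proof (intro iffI allI impI ballI)
    fix d Y
    assume less: "m - t < min_weight G s n P" and d: "(\<Sum>i=1..s. d i) = m - t"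
      and Y: "Y \<in> carrier (matrix_group G s n)"
    have "?b ^ (\<Sum>i=1..s. d i) * card (?A d Y) = card P"
    proof (rule card_fibre[OF P Y])
      show "d i \<le> n" if "i \<in> {1..s}" for i
        using member_le_sum[of i "{1..s}" d] that d m by simp
      show "K = \<one>\<^bsub>matrix_group ?D s n\<^esub>"
        if "K \<in> perp G s n P" "\<And>i. i \<in> {1..s} \<Longrightarrow> nrt_weight ?D n (K i) \<le> d i" for K
      proof (rule ccontr)
        assume "K \<noteq> \<one>\<^bsub>matrix_group ?D s n\<^esub>"
        with min_weight_le[OF that(1)] less have "m - t < matrix_weight ?D s n K" by simp
        moreover have "matrix_weight ?D s n K \<le> (\<Sum>i=1..s. d i)"
          unfolding matrix_weight_def using that(2) by (intro sum_mono) auto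
        ultimately show False using d by simp
      qed
    qed
    then have "?b ^ (m - t) * card (?A d Y) = ?b ^ (m - t) * ?b ^ t"
      using d card t by (simp add: power_add[symmetric])
    then show "card (?A d Y) = ?b ^ t" using order_pos by simp
  next
    assume fib: "\<forall>d. (\<Sum>i=1..s. d i) = m - t \<longrightarrow>
      (\<forall>Y\<in>carrier (matrix_group G s n). card (?A d Y) = ?b ^ t)"
    show "m - t < min_weight G s n P"
    proof (rule ccontr)
      assume le: "\<not> m - t < min_weight G s n P"
      \<comment> \<open>From \<open>m - t \<le> n \<le> n * s\<close> the default value of
        \<open>min_weight\<close> is excluded, so the minimum is attained by an actual
        \<open>K\<close>.\<close>
      have "n \<le> n * s" using s by simp
      then have "min_weight G s n P \<le> n * s" using le m by linarith
      then obtain K where K: "K \<in> perp G s n P"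
        "matrix_weight ?D s n K = min_weight G s n P" by (rule min_weight_attained)
      have KM: "K \<in> carrier (matrix_group ?D s n)" using K by (simp add: perp_def)
      \<comment> \<open>The row weights of \<open>K\<close>, padded in the first row to the total \<open>m - t\<close>.\<close>
      define d where "d = (\<lambda>i. nrt_weight ?D n (K i) +
        (if i = 1 then m - t - min_weight G s n P else 0))"
      have "(\<Sum>i=1..s. d i) = matrix_weight ?D s n K + (m - t - min_weight G s n P)"
        using s by (simp add: d_def sum.distrib matrix_weight_def)
      then have d: "(\<Sum>i=1..s. d i) = m - t" using K le by simp
      have "K \<noteq> \<one>\<^bsub>matrix_group ?D s n\<^esub>"
        using matrix_weight_eq_0_iff[OF KM] K min_weight_bounds(1)[of G s n P] by auto
      then obtain i0 j0 where ij: "i0 \<in> {1..s}" "j0 \<in> {1..n}" "K i0 j0 \<noteq> \<one>\<^bsub>?D\<^esub>"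
        using matrix_eq_one_iff[OF KM] by blast
      have "K i0 j0 \<in> carrier ?D" by (rule matrix_entry[OF KM ij(1,2)])
      then obtain g where g: "g \<in> carrier G" "K i0 j0 g \<noteq> 1"
        using ij(3) by (auto simp: carrier_dual_group one_dual_group extensional_def fun_eq_iff split: if_splits)
      \<comment> \<open>The entry \<open>g\<close>, where \<open>K i0 j0\<close> differs from 1, is
        the only one that contributes to the pairing. Hence \<open>K\<close> pairs to
        \<open>K i0 j0 g\<close> with every \<open>X\<close> in the fibre of \<open>Y\<close>, which
        is incompatible with \<open>K\<close> in \<open>perp\<close> once the fibre contains a point
        of \<open>P\<close>.\<close>
      define Y where "Y = (\<lambda>i\<in>{1..s}. \<lambda>j\<in>{1..n}. if i = i0 \<and> j = j0 then g else \<one>)"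
      have "Y \<in> carrier (matrix_group G s n)"
        using g(1) by (auto simp: Y_def carrier_matrix_group carrier_row_group)
      then have "card (?A d Y) \<noteq> 0" using fib d order_pos by simp
      then have "?A d Y \<noteq> {}" by (rule contrapos_nn) (simp only: card.empty)
      then have "\<exists>X. X \<in> ?A d Y" unfolding ex_in_conv .
      then obtain X where X: "X \<in> ?A d Y" ..
      have entry: "K i j (X i j) = (if i = i0 \<and> j = j0 then K i0 j0 g else 1)"
        if "i \<in> {1..s}" "j \<in> {1..n}" for i j
      proof (cases "j \<le> d i")
        case True
        then have "X i j = Y i j" using X that by blast
        then show ?thesis
          using that dual_group_at_one[OF matrix_entry[OF KM that]] by (simp add: Y_def)
      next
        case False
        \<comment> \<open>The depth \<open>d i\<close> is at least the weight of row
          \<open>i\<close>, so \<open>K\<close> is trivial at all entries that \<open>Y\<close>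
          leaves unprescribed; in particular \<open>(i0, j0)\<close> is not among them.\<close>
        then have "K i j = \<one>\<^bsub>?D\<^esub>"
          using nrt_weight_le_iff[OF matrix_row[OF KM that(1)], of "d i"] that by (auto simp: d_def)
        moreover have "X i j \<in> carrier G" using X PM that by (auto intro: matrix_entry)
        ultimately show ?thesis using ij(3) by (auto simp: one_dual_group)
      qed
      have "pairing s n K X =
        (\<Prod>i=1..s. \<Prod>j=1..n. if i = i0 \<and> j = j0 then K i0 j0 g else 1)"
        unfolding pairing_def by (intro prod.cong refl entry)
      also have "\<dots> = (\<Prod>i=1..s. if i = i0 then K i0 j0 g else 1)"
        using ij(2) by (intro prod.cong refl) auto
      also have "\<dots> = K i0 j0 g" using ij(1) by simp
      finally show False using K(1) X g(2) by (auto simp: perp_def)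
    qed
  qed
qed

end

end

theorem theorem2:
  fixes G :: "('a, 'm) monoid_scheme"
    and b s n :: nat
    and \<phi> :: "nat \<Rightarrow> 'a"
    and P :: "(nat \<Rightarrow> nat \<Rightarrow> 'a) set"
  assumes "comm_group G" and "finite (carrier G)"
    and "b = order G" and "b \<ge> 2"
    and "s \<ge> 1" and "n \<ge> 1"
    and "bij_betw \<phi> {..<b} (carrier G)" and "\<phi> 0 = \<one>\<^bsub>G\<^esub>"
    and "subgroup P (matrix_group G s n)"
  shows "(\<forall>z :: complex.
            (\<Sum>a=0..n * s. of_nat (weight_count G s n P a) * z ^ a) =
            1 / of_nat (card P) *
              (\<Sum>X\<in>P. \<Prod>i=1..s. p_poly b n (dual_nrt_weight G n (X i)) z))
       \<and> (\<forall>m. card P = b ^ m \<and> 1 \<le> m \<and> m \<le> n \<longrightarrow>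
            (\<exists>t. int t = int m + 1 - int (min_weight G s n P) \<and>
                 is_strict_net b \<phi> t m s n P))"
proof -
  interpret finite_comm_group G
    using assms(1,2) by (simp add: finite_comm_group_def finite_comm_group_axioms_def)
  note P = assms(9)
  have \<phi>: "bij_betw \<phi> {..<order G} (carrier G)" using assms(3,7) by simp
  have "\<exists>t. int t = int m + 1 - int (min_weight G s n P) \<and> is_strict_net b \<phi> t m s n P"
    if m: "card P = b ^ m" "m \<le> n" for m
  proof -
    let ?\<rho> = "min_weight G s n P"
    have card: "card P = order G ^ m" using m assms(3) by simp
    have net: "is_net b t m s (to_point b \<phi> s n ` P) \<longleftrightarrow> m - t < ?\<rho>" if "t \<le> m" for t
      using is_net_iff_min_weight[OF \<phi> P card that m(2) assms(5)] assms(3) by simp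
    have \<rho>: "1 \<le> ?\<rho>" "?\<rho> \<le> m + 1"
      using min_weight_bounds(1) min_weight_le_Suc[OF P card] assms(3,4) by auto
    \<comment> \<open>The bound \<open>1 \<le> ?\<rho>\<close> gives \<open>?t \<le> m\<close>, and
      \<open>?\<rho> \<le> m + 1\<close> makes the subtraction exact. Then
      \<open>m - ?t = ?\<rho> - 1\<close> is the largest value below \<open>?\<rho>\<close>.\<close>
    let ?t = "m + 1 - ?\<rho>"
    have "is_net b ?t m s (to_point b \<phi> s n ` P)" using net[of ?t] \<rho> by simp
    moreover have "?t \<le> t'" if "is_net b t' m s (to_point b \<phi> s n ` P)" for t'
    proof -
      have "t' \<le> m" using that by (simp add: is_net_def)
      then show ?thesis using net[of t'] that by simp
    qed
    ultimately have "is_strict_net b \<phi> ?t m s n P" by (simp add: is_strict_net_def)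
    moreover have "int ?t = int m + 1 - int ?\<rho>" using \<rho> by simp
    ultimately show ?thesis by blast
  qed
  then show ?thesis using weight_enumerator[OF P] assms(3) by simp
qed

end
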